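(* Let $\Phi:\mathbb R\to\mathbb R$ be a continuous, integrable, positive-semidefinite function and $K(x,y)=\Phi(x-y)$ the associated stationary positive-semidefinite kernel. Let $p\in\{2,\infty\}$. Suppose that there is a constant $\Phi_{\min}$ with $0<\Phi_{\min}\le|\Phi(x)|$ for all $x\in[-1,1]$, that the Fourier transform $\widehat\Phi$ is infinitely differentiable, and that, with $$\beta_k=\frac1{\sqrt{2\pi}}\int_{\mathbb R}\frac{\widehat\Phi^{(k)}(\omega)^2}{\widehat\Phi(\omega)}\,d\omega,\qquad k\ge0,$$ there is a constant $\lambda>0$ such that $$\beta_n<\infty\quad\text{and}\quad\frac{\beta_k}{\beta_n}\le\lambda^{n-k}\frac{k!}{n!}\quad\text{for all } n\ge0,\ 0\le k\le n.$$ Set $$\tilde c_{1,\infty}=\sqrt{\frac{2}{1+\lambda}}\,e^{-\frac1{32}\lambda^2}\Phi_{\min},\qquad\tilde c_{1,2}=\frac{2\sqrt{2\pi}}{3e^3\sqrt{3(4+\lambda)}}\,e^{-\frac1{32}\lambda^2}\Phi_{\min}.$$ Then, for every $n\ge1$ and all $x_1,\dots,x_n\in[-1,1]$, $$\tilde c_{1,p}\,(n+1)^{-1/2}\,2^{-n}\beta_n^{-1/2}\le e_p^{\min}(x_1,\dots,x_n),$$ $$\tilde c_{1,p}\,(n+1)^{-1/2}\,2^{-n}\beta_n^{-1/2}\le e_p^{\min}(n),$$ and, for every $x\in[-1,1]\setminus\{x_1,\dots,x_n\}$, $$\tilde c_{1,\infty}\,(n+1)^{-1/2}\,2^{-2n}\beta_n^{-1/2}\le\frac{e^{\min}(x\mid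 x_1,\dots,x_n)}{|\prod_{k=1}^n(x-x_k)|}.$$
   Context: The Fourier transform is $\widehat\Phi(\omega)=\frac1{\sqrt{2\pi}}\int_{\mathbb R}\Phi(x)e^{\mathrm ix\omega}\,dx$, which is real and non-negative by Bochner's theorem. $H(K)$ is the reproducing kernel Hilbert space of $K$, consisting of the (continuous) functions $$H(K)=\Big\{f\in L^2(\mathbb R)\ :\ \|f\|_K^2=\frac1{\sqrt{2\pi}}\int_{\mathbb R}\frac{|\widehat f(\omega)|^2}{\widehat\Phi(\omega)}\,d\omega<\infty\Big\}.$$ In integrals with $\widehat\Phi$ in the denominator, $0/0$ is read as $0$ and $c/0$ as $+\infty$ for $c>0$. $L^p=L^p([-1,1])$ with norm $\|\cdot\|_p$, and elements of $H(K)$ are restricted to $[-1,1]$ in the errors below. The worst-case errors are $$e_p^{\min}(x_1,\dots,x_n)=\inf_{\psi_1,\dots,\psi_n\in L^p}\ \sup_{0\ne f\in H(K)}\frac{\|f-\sum_{k=1}^n f(x_k)\psi_k\|_p}{\|f\|_K},\qquad e_p^{\min}(n)=\inf_{x_1,\dots,x_n\in[-1,1]}e_p^{\min}(x_1,\dots,x_n),$$ $$e^{\min}(x\mid x_1,\dots,x_n)=\inf_{u_1,\dots,u_n\in\mathbb R}\ \sup_{0\ne f\in H(K)}\frac{|f(x)-\sum_{k=1}^n f(x_k)u_k|}{\|f\|_K}.$$ *)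

theory Defs
  imports "HOL-Probability.Probability"
begin

section \<open>Stationary positive-semidefinite kernels\<close>

text \<open>
  For a real kernel, symmetry is part of positive semidefiniteness: the inequality for real
  coefficients alone does not see the antisymmetric part of \<open>K\<close>.
\<close>

definition psd_kernel :: "(real \<Rightarrow> real \<Rightarrow> real) \<Rightarrow> bool" where
  "psd_kernel K \<longleftrightarrow>
     (\<forall>x y. K x y = K y x) \<and>
     (\<forall>(n::nat) (x :: nat \<Rightarrow> real) (c :: nat \<Rightarrow> real).
        0 \<le> (\<Sum>i<n. \<Sum>j<n. c i * c j * K (x i) (x j)))"

definition psd_function :: "(real \<Rightarrow> real) \<Rightarrow> bool" where
  "psd_function \<Phi> \<longleftrightarrow> psd_kernel (\<lambda>x y. \<Phi> (x - y))"


section \<open>Fourier transforms on \<open>L\<^sup>1\<close> and \<open>L\<^sup>2\<close>\<close>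

definition fourier :: "(real \<Rightarrow> real) \<Rightarrow> real \<Rightarrow> complex" where
  "fourier f \<omega> =
     complex_of_real (1 / sqrt (2 * pi)) * (CLINT x|lborel. complex_of_real (f x) * iexp (x * \<omega>))"

text \<open>
  \<open>fourier\<close> is meaningful only for integrable functions.  For square-integrable \<open>f\<close> the Fourier
  transform is the \<open>L\<^sup>2\<close>-limit of the transforms of the truncations of \<open>f\<close> to \<open>[-R, R]\<close>, which are
  integrable; by Plancherel's theorem the limit exists, and it is unique up to null sets.
\<close>

definition has_fourier_L2 :: "(real \<Rightarrow> real) \<Rightarrow> (real \<Rightarrow> complex) \<Rightarrow> bool" where
  "has_fourier_L2 f g \<longleftrightarrow>
     g \<in> borel_measurable lborel \<and>
     (\<integral>\<^sup>+\<omega>. ennreal ((norm (g \<omega>))\<^sup>2) \<partial>lborel) < \<infinity> \<and>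
     ((\<lambda>R. \<integral>\<^sup>+\<omega>. ennreal ((norm (fourier (\<lambda>x. indicator {-R..R} x * f x) \<omega> - g \<omega>))\<^sup>2) \<partial>lborel)
        \<longlongrightarrow> 0) at_top"

definition fourier_L2 :: "(real \<Rightarrow> real) \<Rightarrow> real \<Rightarrow> complex" where
  "fourier_L2 f = (SOME g. has_fourier_L2 f g)"

text \<open>
  For a continuous, integrable, positive-semidefinite \<open>\<Phi>\<close> the transform is real-valued and
  non-negative (Bochner), so taking the real part loses nothing and gives a function to which the
  real derivative \<open>deriv\<close> applies.
\<close>

definition fourier_real :: "(real \<Rightarrow> real) \<Rightarrow> real \<Rightarrow> real" where
  "fourier_real \<Phi> \<omega> = Re (fourier \<Phi> \<omega>)"

definition infinitely_differentiable :: "(real \<Rightarrow> real) \<Rightarrow> bool" where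
  "infinitely_differentiable g \<longleftrightarrow> (\<forall>k. (deriv ^^ k) g differentiable_on UNIV)"


section \<open>The space \<open>H(K)\<close> for \<open>K(x, y) = \<Phi>(x - y)\<close>\<close>

text \<open>
  Division on \<^typ>\<open>ennreal\<close> satisfies \<open>0 / 0 = 0\<close> and \<open>c / 0 = \<infinity>\<close> for \<open>c > 0\<close>, which is the
  convention required for the quotients by the Fourier transform of \<open>\<Phi>\<close> below.
\<close>

definition H_norm_sq :: "(real \<Rightarrow> real) \<Rightarrow> (real \<Rightarrow> real) \<Rightarrow> ennreal" where
  "H_norm_sq \<Phi> f =
     ennreal (1 / sqrt (2 * pi)) *
       (\<integral>\<^sup>+\<omega>. ennreal ((norm (fourier_L2 f \<omega>))\<^sup>2) / ennreal (fourier_real \<Phi> \<omega>) \<partial>lborel)"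

definition H_space :: "(real \<Rightarrow> real) \<Rightarrow> (real \<Rightarrow> real) set" where
  "H_space \<Phi> =
     {f. continuous_on UNIV f \<and> integrable lborel (\<lambda>x. (f x)\<^sup>2) \<and> H_norm_sq \<Phi> f < \<infinity>}"

definition H_norm :: "(real \<Rightarrow> real) \<Rightarrow> (real \<Rightarrow> real) \<Rightarrow> real" where
  "H_norm \<Phi> f = sqrt (enn2real (H_norm_sq \<Phi> f))"

definition beta :: "(real \<Rightarrow> real) \<Rightarrow> nat \<Rightarrow> ennreal" where
  "beta \<Phi> k =
     ennreal (1 / sqrt (2 * pi)) *
       (\<integral>\<^sup>+\<omega>. ennreal (((deriv ^^ k) (fourier_real \<Phi>) \<omega>)\<^sup>2) / ennreal (fourier_real \<Phi> \<omega>) \<partial>lborel)"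


section \<open>\<open>L\<^sup>p([-1, 1])\<close> and worst-case errors\<close>

definition Lp_norm :: "ennreal \<Rightarrow> (real \<Rightarrow> real) \<Rightarrow> ennreal" where
  "Lp_norm p g =
     (if p = \<infinity> then esssup (lebesgue_on {-1..1}) (\<lambda>x. ennreal \<bar>g x\<bar>)
      else (let I = (\<integral>\<^sup>+x. ennreal (\<bar>g x\<bar> powr enn2real p) \<partial>lebesgue_on {-1..1})
            in if I = \<infinity> then \<infinity> else ennreal (enn2real I powr (1 / enn2real p))))"

definition Lp_space :: "ennreal \<Rightarrow> (real \<Rightarrow> real) set" where
  "Lp_space p = {g. g \<in> borel_measurable (lebesgue_on {-1..1}) \<and> Lp_norm p g < \<infinity>}"

text \<open>
  The sample points \<open>x\<^sub>1, \<dots>, x\<^sub>n\<close> are the values of \<open>x :: nat \<Rightarrow> real\<close> on \<open>{1..n}\<close>; they need not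
  be distinct.  The condition \<open>f \<noteq> 0\<close> concerns \<open>f\<close> on the whole real line.
\<close>

definition e_min_pts ::
    "(real \<Rightarrow> real) \<Rightarrow> ennreal \<Rightarrow> nat \<Rightarrow> (nat \<Rightarrow> real) \<Rightarrow> ennreal" where
  "e_min_pts \<Phi> p n x =
     (INF \<psi> \<in> {\<psi> :: nat \<Rightarrow> real \<Rightarrow> real. \<forall>k\<in>{1..n}. \<psi> k \<in> Lp_space p}.
        SUP f \<in> H_space \<Phi> - {\<lambda>_. 0}.
          Lp_norm p (\<lambda>t. f t - (\<Sum>k=1..n. f (x k) * \<psi> k t)) / ennreal (H_norm \<Phi> f))"

definition e_min :: "(real \<Rightarrow> real) \<Rightarrow> ennreal \<Rightarrow> nat \<Rightarrow> ennreal" where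
  "e_min \<Phi> p n =
     (INF x \<in> {x :: nat \<Rightarrow> real. \<forall>k\<in>{1..n}. x k \<in> {-1..1}}. e_min_pts \<Phi> p n x)"

definition e_min_at ::
    "(real \<Rightarrow> real) \<Rightarrow> nat \<Rightarrow> (nat \<Rightarrow> real) \<Rightarrow> real \<Rightarrow> ennreal" where
  "e_min_at \<Phi> n x t =
     (INF u \<in> (UNIV :: (nat \<Rightarrow> real) set).
        SUP f \<in> H_space \<Phi> - {\<lambda>_. 0}.
          ennreal \<bar>f t - (\<Sum>k=1..n. f (x k) * u k)\<bar> / ennreal (H_norm \<Phi> f))"


section \<open>The constants\<close>

definition c1_inf :: "real \<Rightarrow> real \<Rightarrow> real" where
  "c1_inf lam \<Phi>min = sqrt (2 / (1 + lam)) * exp (- (1 / 32) * lam\<^sup>2) * \<Phi>min"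

definition c1_two :: "real \<Rightarrow> real \<Rightarrow> real" where
  "c1_two lam \<Phi>min =
     2 * sqrt (2 * pi) / (3 * exp 3 * sqrt (3 * (4 + lam))) * exp (- (1 / 32) * lam\<^sup>2) * \<Phi>min"

definition c1 :: "ennreal \<Rightarrow> real \<Rightarrow> real \<Rightarrow> real" where
  "c1 p lam \<Phi>min = (if p = \<infinity> then c1_inf lam \<Phi>min else c1_two lam \<Phi>min)"

end

theory Submission
  imports Defs
begin

text \<open>
  A method that only sees \<open>f (x 1), \<dots>, f (x n)\<close> cannot distinguish \<open>0\<close> from a function that vanishes
  at all sample points.  Let \<open>q(t) = (t - x 1) \<cdots> (t - x n) = a\<^sub>0 + \<dots> + a\<^sub>n t\<^sup>n\<close>.  The function
  \<open>f = q \<Phi>\<close> is such a function, so every worst-case error is at least the size of \<open>f\<close> divided by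
  \<open>\<parallel>f\<parallel>\<^sub>K\<close>.  The size of \<open>f\<close> is at least \<open>\<Phi>min\<close> times that of \<open>q\<close>.

  The norm is accessible because multiplication by \<open>x\<close> becomes differentiation of the transform:
  the transform of \<open>f\<close> is the sum of the \<open>a\<^sub>k (- \<i>)\<^sup>k D\<^sup>k\<close>, where \<open>D\<^sup>k\<close> is the \<open>k\<close>-th derivative of the
  transform of \<open>\<Phi>\<close>.  By the Cauchy-Schwarz inequality and the hypothesis on the \<open>\<beta>\<^sub>k\<close>,
  \<open>\<parallel>f\<parallel>\<^sub>K\<^sup>2 \<le> (n + 1) (a\<^sub>0\<^sup>2 \<beta>\<^sub>0 + \<dots> + a\<^sub>n\<^sup>2 \<beta>\<^sub>n) \<le> (n + 1) \<beta>\<^sub>n S\<close>, with \<open>S\<close> the sum of the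
  \<open>a\<^sub>k\<^sup>2 \<lambda>\<^bsup>n-k\<^esup> k! / n!\<close> (\<open>H_norm_poly_kernel_sq_le\<close>).

  What remains is a statement about polynomials: \<open>S\<close> is bounded by the supremum norm or by the
  \<open>L\<^sup>2\<close> norm of \<open>q\<close> on \<open>[-1, 1]\<close>, at the price of a factor \<open>4\<^sup>n\<close> (\<open>coeff_weighted_sum_le_sup\<close>,
  \<open>coeff_weighted_sum_le_L2\<close>).  Both bounds come from expanding \<open>q\<close> in the Chebyshev polynomials
  of the second kind \<open>U\<^sub>j\<close>.  The substitution \<open>t = cos \<theta>\<close> turns the expansion into a sine series, whose
  coefficients are controlled by Parseval's identity, and the monomial coefficients of the \<open>U\<^sub>j\<close> are
  explicit binomial numbers.  At a single point \<open>t\<close> the supremum bound with \<open>\<bar>q\<bar> \<le> 2\<^sup>n\<close> on \<open>[-1, 1]\<close>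
  suffices.

  The analytic part is to justify the formula for the transform of \<open>f\<close>, for which the moments
  \<open>x\<^sup>k \<Phi>(x)\<close> have to be integrable.  Positive semidefiniteness makes \<open>\<Phi>\<close> bounded and even.  Finiteness of \<open>\<beta>\<^sub>0\<close> and \<open>\<beta>\<^sub>k\<close> makes \<open>D\<^sup>k\<close> integrable.  Fourier inversion
  and integration by parts then show that every \<open>x\<^sup>k \<Phi>(x)\<close> is bounded, hence, with \<open>k\<close> replaced by
  \<open>k + 2\<close>, integrable, and a second inversion identifies its transform (\<open>FT_moment\<close>).  Inversion and the
  inequality half of Plancherel's theorem, which is needed to pass from the transform on \<open>L\<^sup>1\<close> to the
  one on \<open>L\<^sup>2\<close>, are both obtained by damping with a Gaussian.
\<close>


section \<open>Chebyshev polynomials of the second kind\<close>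

fun chebU :: "nat \<Rightarrow> real poly" where
  "chebU 0 = 1"
| "chebU (Suc 0) = [:0, 2:]"
| "chebU (Suc (Suc n)) = [:0, 2:] * chebU (Suc n) - chebU n"

lemma coeff_chebU_Suc_Suc:
  "coeff (chebU (Suc (Suc n))) 0 = - coeff (chebU n) 0"
  "coeff (chebU (Suc (Suc n))) (Suc k) = 2 * coeff (chebU (Suc n)) k - coeff (chebU n) (Suc k)"
  by simp_all

lemma poly_chebU_Suc_Suc:
  "poly (chebU (Suc (Suc n))) x = 2 * x * poly (chebU (Suc n)) x - poly (chebU n) x"
  by simp

declare chebU.simps(3) [simp del]

lemma coeff_chebU_eq_0: "j < k \<or> odd (j + k) \<Longrightarrow> coeff (chebU j) k = 0"
proof (induction j arbitrary: k rule: chebU.induct)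
  case (3 n)
  show ?case
  proof (cases k)
    case 0
    then show ?thesis using 3 by (simp add: coeff_chebU_Suc_Suc)
  next
    case (Suc k')
    then show ?thesis using 3(1)[of k'] 3(2)[of "Suc k'"] 3(3) by (auto simp: coeff_chebU_Suc_Suc)
  qed
qed (auto simp: coeff_pCons odd_pos split: nat.splits)

text \<open>
  Equality holds up to the sign \<open>(- 1)\<^sup>m\<close>.  The pair \<open>(k, m)\<close> parametrises the coefficients of the right
  parity, which are the only ones that can be nonzero.
\<close>
lemma abs_coeff_chebU_le: "\<bar>coeff (chebU (k + 2 * m)) k\<bar> \<le> 2 ^ k * real ((k + m) choose m)"
proof -
  have "\<bar>coeff (chebU j) k\<bar> \<le> 2 ^ k * real ((k + m) choose m)" if "j = k + 2 * m" for j k m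
    using that
  proof (induction j arbitrary: k m rule: chebU.induct)
    case 1
    then show ?case by auto
  next
    case 2
    then have "k = 1 \<and> m = 0" by arith
    then show ?case by simp
  next
    \<comment> \<open>Pascal's rule for \<open>k + m choose m\<close> is the recurrence read at the coefficient \<open>k\<close>.
      The \<open>if\<close> covers the leading coefficient, to which \<open>U\<^sub>n\<close> does not contribute.\<close>
    case (3 n)
    have step: "\<bar>coeff (chebU n) k\<bar> \<le> 2 ^ k * (if m = 0 then 0 else real ((k + m - 1) choose (m - 1)))"
    proof (cases m)
      case 0
      then show ?thesis using coeff_chebU_eq_0[of n k] 3(3) by simp
    next
      case (Suc m')
      then show ?thesis using 3(2)[of k m'] 3(3) by simp
    qed
    show ?case
    proof (cases k)
      case 0
      then have "m \<noteq> 0" using 3(3) by auto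
      then show ?thesis using step 0 by (simp add: coeff_chebU_Suc_Suc)
    next
      case (Suc k')
      have "\<bar>coeff (chebU (Suc n)) k'\<bar> \<le> 2 ^ k' * real ((k' + m) choose m)"
        using 3(1)[of k' m] 3(3) Suc by simp
      then have "\<bar>coeff (chebU (Suc (Suc n))) k\<bar> \<le> 2 ^ k * real ((k' + m) choose m)
          + 2 ^ k * (if m = 0 then 0 else real ((k + m - 1) choose (m - 1)))"
        using step unfolding Suc coeff_chebU_Suc_Suc by simp
      also have "\<dots> = 2 ^ k * real ((k + m) choose m)"
        using Suc by (cases m) (simp_all add: algebra_simps)
      finally show ?thesis .
    qed
  qed
  then show ?thesis by blast
qed

lemma lead_coeff_chebU: "coeff (chebU n) n = 2 ^ n"
proof (induction n rule: chebU.induct)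
  case (3 n)
  then show ?case using coeff_chebU_eq_0[of n "Suc (Suc n)"] by (simp add: coeff_chebU_Suc_Suc)
qed auto

lemma chebU_expansion:
  assumes "degree q \<le> n"
  shows "\<exists>b. q = (\<Sum>j\<le>n. smult (b j) (chebU j))"
  using assms
proof (induction n arbitrary: q)
  case 0
  then obtain a where "q = [:a:]" by (auto elim: degree_eq_zeroE)
  then show ?case by (intro exI[of _ "\<lambda>_. a"]) simp
next
  case (Suc n)
  define c where "c = coeff q (Suc n) / 2 ^ Suc n"
  have "degree (q - smult c (chebU (Suc n))) \<le> n"
  proof (rule degree_le, intro allI impI)
    fix i assume "n < i"
    then consider "i = Suc n" | "i > Suc n" by linarith
    then show "coeff (q - smult c (chebU (Suc n))) i = 0"
    proof cases
      case 1
      then show ?thesis by (simp add: c_def lead_coeff_chebU del: chebU.simps)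
    next
      case 2
      then show ?thesis using Suc.prems by (simp add: coeff_chebU_eq_0 coeff_eq_0 del: chebU.simps)
    qed
  qed
  from Suc.IH[OF this] obtain b where b: "q - smult c (chebU (Suc n)) = (\<Sum>j\<le>n. smult (b j) (chebU j))"
    by blast
  have "q = (\<Sum>j\<le>Suc n. smult ((b(Suc n := c)) j) (chebU j))"
    using b by (simp add: algebra_simps del: chebU.simps)
  then show ?case by blast
qed

lemma chebU_cos_mult_sin: "poly (chebU n) (cos t) * sin t = sin (real (Suc n) * t)"
proof (induction n rule: chebU.induct)
  case 2
  then show ?case by (simp add: sin_double)
next
  case (3 n)
  define a where "a = real (Suc (Suc n)) * t"
  have "real (Suc (Suc (Suc n))) * t = a + t" "real (Suc n) * t = a - t"
    unfolding a_def by (simp_all add: algebra_simps)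
  then have "poly (chebU (Suc n)) (cos t) * sin t = sin a" "poly (chebU n) (cos t) * sin t = sin (a - t)"
    using 3 by (simp_all add: a_def)
  moreover have "poly (chebU (Suc (Suc n))) (cos t) * sin t =
      2 * cos t * (poly (chebU (Suc n)) (cos t) * sin t) - poly (chebU n) (cos t) * sin t"
    by (simp add: poly_chebU_Suc_Suc algebra_simps)
  ultimately show ?case unfolding \<open>real (Suc (Suc (Suc n))) * t = a + t\<close>
    by (simp add: sin_add sin_diff)
qed auto

text \<open>
  This step of two in the index telescopes to \<open>U\<^sub>n(cos t) = 2 cos (n t) + 2 cos ((n - 2) t) + \<dots>\<close>,
  which makes the cosine coefficients of \<open>U\<^sub>n(cos t)\<close> visible.
\<close>
lemma chebU_cos_Suc_Suc:
  "poly (chebU (Suc (Suc n))) (cos t) = poly (chebU n) (cos t) + 2 * cos (real (Suc (Suc n)) * t)"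
proof (induction n rule: chebU.induct)
  case 1
  then show ?case by (simp add: poly_chebU_Suc_Suc cos_double_cos power2_eq_square)
next
  case 2
  have "cos (3 * t) = 4 * cos t ^ 3 - 3 * cos t" by (rule cos_treble_cos)
  then show ?case by (simp add: poly_chebU_Suc_Suc algebra_simps power3_eq_cube)
next
  case (3 n)
  define a where "a = real (Suc (Suc (Suc n))) * t"
  have e: "real (Suc (Suc (Suc (Suc n)))) * t = a + t" "real (Suc (Suc n)) * t = a - t"
    unfolding a_def by (simp_all add: algebra_simps)
  have "poly (chebU (Suc (Suc (Suc n)))) (cos t) = poly (chebU (Suc n)) (cos t) + 2 * cos a"
       "poly (chebU (Suc (Suc n))) (cos t) = poly (chebU n) (cos t) + 2 * cos (a - t)"
    using 3 by (simp_all only: a_def e(2)[unfolded a_def])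
  then show ?case unfolding e(1) poly_chebU_Suc_Suc[of "Suc (Suc n)"] cos_add cos_diff
    using poly_chebU_Suc_Suc[of n "cos t"] by (simp add: algebra_simps)
qed

lemma cos_integral_pi:
  "((\<lambda>t. cos (real k * t)) has_integral (if k = 0 then pi else 0)) {0..pi}"
proof (cases "k = 0")
  case True
  then show ?thesis using has_integral_const_real[of "1::real" 0 pi] by simp
next
  case False
  have "((\<lambda>t. cos (real k * t)) has_integral (sin (real k * pi) / k - sin (real k * 0) / k)) {0..pi}"
    by (rule fundamental_theorem_of_calculus)
       (use False in \<open>auto intro!: derivative_eq_intros simp: has_real_derivative_iff_has_vector_derivative[symmetric]\<close>)
  then show ?thesis using False by simp
qed

lemma cos_cos_integral_pi:
  assumes "j \<le> n" "n \<ge> 1"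
  shows "((\<lambda>t. cos (real j * t) * cos (real n * t)) has_integral (if j = n then pi / 2 else 0)) {0..pi}"
proof -
  have *: "cos (real j * t) * cos (real n * t) = (cos (real (n - j) * t) + cos (real (n + j) * t)) * (1/2)" for t
  proof -
    have "real (n - j) * t = real n * t - real j * t" "real (n + j) * t = real n * t + real j * t"
      using assms by (simp_all add: algebra_simps of_nat_diff)
    then show ?thesis by (simp only: cos_add cos_diff) simp
  qed
  have "((\<lambda>t. (cos (real (n - j) * t) + cos (real (n + j) * t)) * (1/2)) has_integral
     ((if n - j = 0 then pi else 0) + (if n + j = 0 then pi else 0)) * (1/2)) {0..pi}"
    by (intro has_integral_mult_left has_integral_add cos_integral_pi)
  then show ?thesis unfolding * using assms by (auto split: if_splits)
qed

lemma sin_sin_integral_pi: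
  "((\<lambda>t. sin (real (Suc j) * t) * sin (real (Suc n) * t)) has_integral (if j = n then pi / 2 else 0)) {0..pi}"
proof -
  have le: "((\<lambda>t. sin (real (Suc j) * t) * sin (real (Suc n) * t)) has_integral (if j = n then pi / 2 else 0)) {0..pi}"
    if "j \<le> n" for j n :: nat
  proof -
    have *: "sin (real (Suc j) * t) * sin (real (Suc n) * t) =
        (cos (real (n - j) * t) - cos (real (n + j + 2) * t)) * (1/2)" for t
    proof -
      have "real (n - j) * t = real (Suc n) * t - real (Suc j) * t"
           "real (n + j + 2) * t = real (Suc n) * t + real (Suc j) * t"
        using that by (simp_all add: algebra_simps of_nat_diff)
      then show ?thesis by (simp only: cos_add cos_diff) simp
    qed
    have "((\<lambda>t. (cos (real (n - j) * t) - cos (real (n + j + 2) * t)) * (1/2)) has_integral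
       ((if n - j = 0 then pi else 0) - (if n + j + 2 = 0 then pi else 0)) * (1/2)) {0..pi}"
      by (intro has_integral_mult_left has_integral_diff cos_integral_pi)
    then show ?thesis unfolding * using that by (auto split: if_splits)
  qed
  show ?thesis
  proof (cases "j \<le> n")
    case False
    then show ?thesis using le[of n j] by (simp add: mult.commute)
  qed (rule le)
qed

text \<open>
  Since \<open>U\<^sub>j(cos t) sin t = sin ((j + 1) t)\<close>, the integrand is the square of a sine polynomial.
\<close>
lemma chebU_parseval:
  "((\<lambda>t. (poly (\<Sum>j\<le>n. smult (b j) (chebU j)) (cos t) * sin t)\<^sup>2) has_integral
      pi / 2 * (\<Sum>j\<le>n. (b j)\<^sup>2)) {0..pi}"
proof -
  have *: "(poly (\<Sum>j\<le>n. smult (b j) (chebU j)) (cos t) * sin t)\<^sup>2 =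
     (\<Sum>i\<le>n. \<Sum>j\<le>n. b i * b j * (sin (real (Suc i) * t) * sin (real (Suc j) * t)))" for t
    unfolding poly_sum poly_smult sum_distrib_right mult.assoc chebU_cos_mult_sin
    by (simp add: power2_eq_square sum_product ac_simps)
  have "((\<lambda>t. \<Sum>i\<le>n. \<Sum>j\<le>n. b i * b j * (sin (real (Suc i) * t) * sin (real (Suc j) * t)))
     has_integral (\<Sum>i\<le>n. \<Sum>j\<le>n. b i * b j * (if i = j then pi / 2 else 0))) {0..pi}"
    by (intro has_integral_sum has_integral_mult_right sin_sin_integral_pi) auto
  moreover have "(\<Sum>i\<le>n. \<Sum>j\<le>n. b i * b j * (if i = j then pi / 2 else 0)) = pi / 2 * (\<Sum>j\<le>n. (b j)\<^sup>2)"
    by (simp add: sum_distrib_left power2_eq_square if_distrib sum.delta cong: if_cong)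
       (simp add: mult.commute)
  ultimately show ?thesis unfolding * by simp
qed

text \<open>
  Among the indices up to \<open>n\<close>, testing with \<open>cos (n t)\<close> isolates the top coefficient of an expansion
  in the \<open>U\<^sub>j\<close>, without the weight \<open>sin t\<close> that Parseval's identity carries.
\<close>
lemma chebU_integral_cos:
  assumes "j \<le> n" "n \<ge> 1"
  shows "((\<lambda>t. poly (chebU j) (cos t) * cos (real n * t)) has_integral (if j = n then pi else 0)) {0..pi}"
  using assms
proof (induction j rule: chebU.induct)
  case 1
  then show ?case using cos_integral_pi[of n] by auto
next
  case 2
  then show ?case using has_integral_mult_right[OF cos_cos_integral_pi[of 1 n], of 2]
    by (simp add: ac_simps if_distrib cong: if_cong)
next
  case (3 j)
  have "((\<lambda>t. poly (chebU j) (cos t) * cos (real n * t) + 2 * (cos (real (Suc (Suc j)) * t) * cos (real n * t)))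
     has_integral (if j = n then pi else 0) + 2 * (if Suc (Suc j) = n then pi / 2 else 0)) {0..pi}"
    using 3 by (intro has_integral_add has_integral_mult_right cos_cos_integral_pi) auto
  then show ?case using 3(3) unfolding chebU_cos_Suc_Suc by (auto simp: algebra_simps split: if_splits)
qed

context
  fixes q :: "real poly" and b :: "nat \<Rightarrow> real" and n :: nat
  assumes q: "q = (\<Sum>j\<le>n. smult (b j) (chebU j))"
begin

lemma sum_chebU_coeffs_le_sup:
  assumes "\<And>t. t \<in> {-1..1} \<Longrightarrow> \<bar>poly q t\<bar> \<le> M"
  shows "(\<Sum>j\<le>n. (b j)\<^sup>2) \<le> M\<^sup>2"
proof -
  have "pi / 2 * (\<Sum>j\<le>n. (b j)\<^sup>2) \<le> M\<^sup>2 * (pi / 2)"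
  proof (rule has_integral_le[OF chebU_parseval])
    show "((\<lambda>t. M\<^sup>2 * (sin (real (Suc 0) * t) * sin (real (Suc 0) * t))) has_integral M\<^sup>2 * (pi / 2)) {0..pi}"
      using has_integral_mult_right[OF sin_sin_integral_pi[of 0 0], of "M\<^sup>2"] by simp
  next
    fix t :: real
    have "\<bar>poly q (cos t)\<bar> \<le> M" using assms[of "cos t"] by simp
    then have "(poly q (cos t))\<^sup>2 \<le> M\<^sup>2" using abs_le_square_iff by fastforce
    then show "(poly (\<Sum>j\<le>n. smult (b j) (chebU j)) (cos t) * sin t)\<^sup>2 \<le> M\<^sup>2 * (sin (real (Suc 0) * t) * sin (real (Suc 0) * t))"
      unfolding q[symmetric] power_mult_distrib by (simp add: mult_right_mono flip: power2_eq_square)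
  qed
  then show ?thesis by (simp add: field_simps)
qed

text \<open>
  The \<open>U\<^sub>j\<close> are orthogonal for the weight \<open>sin\<^sup>2\<close> in the angle, and the substitution \<open>u = cos t\<close> accounts
  for one factor \<open>sin t\<close>; the other is at most \<open>1\<close>.
\<close>
lemma sum_chebU_coeffs_le_L2:
  "(\<Sum>j\<le>n. (b j)\<^sup>2) \<le> 2 / pi * integral {-1..1} (\<lambda>t. (poly q t)\<^sup>2)"
proof -
  have int: "((\<lambda>t. (poly q (cos t))\<^sup>2 * sin t) has_integral integral {-1..1} (\<lambda>t. (poly q t)\<^sup>2)) {0..pi}"
  proof -
    \<comment> \<open>\<open>- Q \<circ> cos\<close> is a primitive of the integrand.\<close>
    define Q where "Q = (\<lambda>u. integral {-1..u} (\<lambda>t. (poly q t)\<^sup>2))"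
    have Q: "(Q has_real_derivative (poly q u)\<^sup>2) (at u within {-1..1})" if "u \<in> {-1..1}" for u
      unfolding Q_def using that
      by (intro integral_has_real_derivative continuous_intros)
    have "((\<lambda>t. (poly q (cos t))\<^sup>2 * sin t) has_integral (- Q (cos pi) - - Q (cos 0))) {0..pi}"
    proof (rule fundamental_theorem_of_calculus)
      fix t :: real
      have "((Q \<circ> cos) has_real_derivative (poly q (cos t))\<^sup>2 * (- sin t)) (at t within {0..pi})"
      proof (rule DERIV_image_chain)
        show "(Q has_real_derivative (poly q (cos t))\<^sup>2) (at (cos t) within cos ` {0..pi})"
          by (rule DERIV_subset[OF Q]) auto
        show "(cos has_real_derivative - sin t) (at t within {0..pi})"
          by (rule DERIV_subset[OF DERIV_cos]) simp
      qed
      then show "((\<lambda>t. - Q (cos t)) has_vector_derivative (poly q (cos t))\<^sup>2 * sin t) (at t within {0..pi})"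
        unfolding has_real_derivative_iff_has_vector_derivative[symmetric]
        by (auto dest: DERIV_minus simp: o_def)
    qed simp
    then show ?thesis by (simp add: Q_def)
  qed
  have "pi / 2 * (\<Sum>j\<le>n. (b j)\<^sup>2) \<le> integral {-1..1} (\<lambda>t. (poly q t)\<^sup>2)"
  proof (rule has_integral_le[OF chebU_parseval int])
    fix t :: real assume "t \<in> {0..pi}"
    then have "0 \<le> sin t" by (simp add: sin_ge_zero)
    then have "sin t * sin t \<le> sin t * 1" by (intro mult_left_mono) auto
    then show "(poly (\<Sum>j\<le>n. smult (b j) (chebU j)) (cos t) * sin t)\<^sup>2 \<le> (poly q (cos t))\<^sup>2 * sin t"
      unfolding q[symmetric] power_mult_distrib power2_eq_square[of "sin t"]
      by (simp add: mult_left_mono)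
  qed
  then show ?thesis by (simp add: field_simps)
qed

text \<open>
  Compared with \<open>sum_chebU_coeffs_le_sup\<close> this gains a factor \<open>2\<close> for the top coefficient, which is what
  makes the bound \<open>coeff_weighted_sum_le_sup\<close> hold with constant \<open>1 / 2\<close> as \<open>lam\<close> tends to \<open>0\<close>.  The gain
  comes from pairing \<open>q(cos t)\<close> with \<open>cos (n t)\<close> directly, where the \<open>n\<close>-th cosine coefficient is \<open>2 b\<^sub>n\<close>.
\<close>
lemma chebU_lead_coeff_le_sup:
  assumes "\<And>t. t \<in> {-1..1} \<Longrightarrow> \<bar>poly q t\<bar> \<le> M" "n \<ge> 1"
  shows "(b n)\<^sup>2 \<le> M\<^sup>2 / 2"
proof -
  have "((\<lambda>t. \<Sum>j\<le>n. b j * (poly (chebU j) (cos t) * cos (real n * t))) has_integral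
      (\<Sum>j\<le>n. b j * (if j = n then pi else 0))) {0..pi}"
    using assms(2) by (intro has_integral_sum has_integral_mult_right chebU_integral_cos) auto
  moreover have "(\<Sum>j\<le>n. b j * (if j = n then pi else 0)) = pi * b n"
    by (simp add: if_distrib sum.delta cong: if_cong)
  ultimately have 1: "((\<lambda>t. poly q (cos t) * cos (real n * t)) has_integral pi * b n) {0..pi}"
    unfolding q by (simp add: poly_sum sum_distrib_right mult.assoc)
  have 2: "((\<lambda>t. (2 * b n)\<^sup>2 * (cos (real n * t) * cos (real n * t))) has_integral (2 * b n)\<^sup>2 * (pi / 2)) {0..pi}"
    using has_integral_mult_right[OF cos_cos_integral_pi[of n n], of "(2 * b n)\<^sup>2"] assms(2) by simp
  have 3: "((\<lambda>t. M\<^sup>2) has_integral (M\<^sup>2 * pi)) {0..pi}"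
    using has_integral_const_real[of "M\<^sup>2" 0 pi] by (simp add: mult.commute)
  \<comment> \<open>Bessel's inequality for the single function \<open>cos (n t)\<close>, from \<open>0 \<le> (q(cos t) - 2 b\<^sub>n cos (n t))\<^sup>2\<close>.\<close>
  have "4 * b n * (pi * b n) \<le> M\<^sup>2 * pi + (2 * b n)\<^sup>2 * (pi / 2)"
  proof (rule has_integral_le[OF has_integral_mult_right[OF 1] has_integral_add[OF 3 2]])
    fix t :: real
    have "\<bar>poly q (cos t)\<bar> \<le> M" using assms(1)[of "cos t"] by simp
    then have "(poly q (cos t))\<^sup>2 \<le> M\<^sup>2" using abs_le_square_iff by fastforce
    moreover have "0 \<le> (poly q (cos t) - 2 * b n * cos (real n * t))\<^sup>2" by simp
    ultimately show "4 * b n * (poly q (cos t) * cos (real n * t))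
        \<le> M\<^sup>2 + (2 * b n)\<^sup>2 * (cos (real n * t) * cos (real n * t))"
      by (simp add: power2_eq_square algebra_simps)
  qed
  then have "pi * (2 * (b n)\<^sup>2) \<le> pi * M\<^sup>2" by (simp add: power2_eq_square algebra_simps)
  then show ?thesis by simp
qed

end


section \<open>Coefficient bounds for polynomials on [-1, 1]\<close>

lemma square_power_two: "(2 ^ k)\<^sup>2 = (4::real) ^ k"
  by (simp add: power2_eq_square flip: power_mult_distrib)

text \<open>
  The left-hand side equals \<open>(k + m choose m) / (k + 2 m choose m)\<close>.
\<close>
lemma choose_sq_mult_fact_le:
  "(real ((k + m) choose m))\<^sup>2 * (fact k * (fact m)\<^sup>2 / fact (k + 2 * m)) \<le> 1"
proof -
  have c: "real ((l + m) choose m) * (fact m * fact l) = fact (l + m)" for l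
    using binomial_fact_lemma[of m "l + m"]
    by (metis add_diff_cancel_right' le_add2 mult.commute of_nat_fact of_nat_mult)
  have "(real ((k + m) choose m))\<^sup>2 * (fact k * (fact m)\<^sup>2)
      = real ((k + m) choose m) * (fact m * (real ((k + m) choose m) * (fact m * fact k)))"
    by (simp add: power2_eq_square)
  also have "\<dots> = real ((k + m) choose m) * (fact m * fact (k + m))"
    by (simp only: c)
  also have "\<dots> \<le> real ((k + m + m) choose m) * (fact m * fact (k + m))"
    by (intro mult_right_mono) (auto intro!: binomial_right_mono)
  also have "\<dots> = fact (k + 2 * m)" by (simp only: c) (simp add: mult_2 add.assoc)
  finally show ?thesis by (simp add: divide_simps)
qed

text \<open>
  Times \<open>4\<^sup>k\<close>, the sum of squares on the left is the sum of the squared \<open>k\<close>-th coefficients of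
  \<open>U\<^sub>k, U\<^bsub>k+2\<^esub>, \<dots>, U\<^bsub>k+2m\<^esub>\<close>.  Passing from \<open>m\<close> to \<open>m + 1\<close> multiplies the weight by at most \<open>1 / 2\<close>, and
  the new term is at most \<open>1\<close> after weighting, so the weighted sums stay below those of the geometric series.
\<close>
lemma sum_choose_sq_le:
  "(\<Sum>i\<le>m. (real ((k + i) choose i))\<^sup>2) * (fact k * (fact m)\<^sup>2 / fact (k + 2 * m)) \<le> 2 - 1 / 2 ^ m"
proof (induction m)
  case 0
  then show ?case by simp
next
  case (Suc m)
  define w where "w = (\<lambda>m. fact k * (fact m)\<^sup>2 / fact (k + 2 * m) :: real)"
  define c where "c = (\<lambda>i. (real ((k + i) choose i))\<^sup>2)"
  define r where "r = (real m + 1)\<^sup>2 / ((real k + 2 * m + 2) * (real k + 2 * m + 1))"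
  have w: "w (Suc m) = w m * r"
  proof -
    have "(fact (k + 2 * Suc m) :: real) = ((real k + 2 * m + 2) * (real k + 2 * m + 1)) * fact (k + 2 * m)"
      by (simp add: algebra_simps)
    moreover have "(fact (Suc m) :: real)\<^sup>2 = (real m + 1)\<^sup>2 * (fact m)\<^sup>2"
      by (simp add: power_mult_distrib add.commute)
    ultimately show ?thesis unfolding w_def r_def by (simp only: times_divide_times_eq mult_ac)
  qed
  have r: "r \<le> 1 / 2"
  proof -
    have "(real m + 1)\<^sup>2 * 2 \<le> (2 * real m + 2) * (2 * real m + 1)"
      by (simp add: power2_eq_square algebra_simps)
    also have "\<dots> \<le> (real k + 2 * m + 2) * (real k + 2 * m + 1)"
      by (intro mult_mono) auto
    finally show ?thesis unfolding r_def by (simp add: divide_simps mult.commute)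
  qed
  have IH: "sum c {..m} * w m \<le> 2 - 1 / 2 ^ m" using Suc by (simp add: w_def c_def)
  have "sum c {..Suc m} * w (Suc m) = (sum c {..m} * w m) * r + c (Suc m) * w (Suc m)"
    using w by (simp add: distrib_right)
  also have "\<dots> \<le> (2 - 1 / 2 ^ m) * (1 / 2) + 1"
  proof (intro add_mono mult_mono IH r)
    have "(1::real) / 2 ^ m \<le> 1" by simp
    then show "0 \<le> 2 - 1 / (2::real) ^ m" by linarith
    show "0 \<le> r" by (simp add: r_def)
    show "c (Suc m) * w (Suc m) \<le> 1" unfolding c_def w_def by (rule choose_sq_mult_fact_le)
  qed
  also have "\<dots> = 2 - 1 / 2 ^ Suc m" by (simp add: field_simps)
  finally show ?case by (simp only: c_def w_def)
qed

context
  fixes q :: "real poly" and b :: "nat \<Rightarrow> real" and N :: nat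
  assumes q: "q = (\<Sum>j\<le>N. smult (b j) (chebU j))"
begin

text \<open>
  \<open>N\<close> may exceed \<open>k + 2 m\<close> by one because the same expansion serves both parities of \<open>k\<close>.
\<close>
lemma coeff_eq_sum_chebU:
  assumes "k + 2 * m \<le> N" "N \<le> Suc (k + 2 * m)"
  shows "coeff q k = (\<Sum>i\<le>m. b (k + 2 * i) * coeff (chebU (k + 2 * i)) k)"
proof -
  have "coeff q k = (\<Sum>j\<le>N. b j * coeff (chebU j) k)"
    by (simp add: q coeff_sum)
  also have "\<dots> = (\<Sum>j\<in>(\<lambda>i. k + 2 * i) ` {..m}. b j * coeff (chebU j) k)"
  proof (rule sum.mono_neutral_right)
    show "\<forall>j\<in>{..N} - (\<lambda>i. k + 2 * i) ` {..m}. b j * coeff (chebU j) k = 0"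
    proof
      fix j assume j: "j \<in> {..N} - (\<lambda>i. k + 2 * i) ` {..m}"
      have "j < k \<or> odd (j + k)"
      proof (rule ccontr)
        assume "\<not> (j < k \<or> odd (j + k))"
        then have "k \<le> j" "even (j - k)" by auto
        then obtain i where "j = k + 2 * i" by (metis evenE le_add_diff_inverse)
        with j assms show False by auto
      qed
      then show "b j * coeff (chebU j) k = 0" by (simp add: coeff_chebU_eq_0)
    qed
  qed (use assms in auto)
  also have "\<dots> = (\<Sum>i\<le>m. b (k + 2 * i) * coeff (chebU (k + 2 * i)) k)"
    by (subst sum.reindex) (auto simp: inj_on_def)
  finally show ?thesis .
qed

lemma coeff_sq_le:
  assumes "k + 2 * m \<le> N" "N \<le> Suc (k + 2 * m)"
  shows "(coeff q k)\<^sup>2 * (fact k / fact (k + 2 * m)) \<le> (\<Sum>j\<le>N. (b j)\<^sup>2) * 4 ^ k * ((2 - 1 / 2 ^ m) / (fact m)\<^sup>2)"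
proof -
  let ?B = "\<Sum>j\<le>N. (b j)\<^sup>2"
  have "(\<Sum>i\<le>m. (b (k + 2 * i))\<^sup>2) = (\<Sum>j\<in>(\<lambda>i. k + 2 * i) ` {..m}. (b j)\<^sup>2)"
    by (subst sum.reindex) (auto simp: inj_on_def)
  also have "\<dots> \<le> ?B"
    using assms by (intro sum_mono2) auto
  finally have B: "(\<Sum>i\<le>m. (b (k + 2 * i))\<^sup>2) \<le> ?B" .
  have "(\<Sum>i\<le>m. (coeff (chebU (k + 2 * i)) k)\<^sup>2) \<le> (\<Sum>i\<le>m. (2 ^ k * real ((k + i) choose i))\<^sup>2)"
    by (intro sum_mono) (metis abs_coeff_chebU_le abs_ge_zero power2_abs power_mono)
  also have "\<dots> = 4 ^ k * (\<Sum>i\<le>m. (real ((k + i) choose i))\<^sup>2)"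
    by (simp add: sum_distrib_left power_mult_distrib square_power_two)
  finally have U: "(\<Sum>i\<le>m. (coeff (chebU (k + 2 * i)) k)\<^sup>2) \<le> 4 ^ k * (\<Sum>i\<le>m. (real ((k + i) choose i))\<^sup>2)" .
  have "(coeff q k)\<^sup>2 \<le> (\<Sum>i\<le>m. (b (k + 2 * i))\<^sup>2) * (\<Sum>i\<le>m. (coeff (chebU (k + 2 * i)) k)\<^sup>2)"
    unfolding coeff_eq_sum_chebU[OF assms] by (rule Cauchy_Schwarz_ineq_sum)
  also have "\<dots> \<le> ?B * (4 ^ k * (\<Sum>i\<le>m. (real ((k + i) choose i))\<^sup>2))"
    by (intro mult_mono B U sum_nonneg) auto
  finally have "(coeff q k)\<^sup>2 * (fact k / fact (k + 2 * m)) \<le>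
      ?B * (4 ^ k * (\<Sum>i\<le>m. (real ((k + i) choose i))\<^sup>2)) * (fact k / fact (k + 2 * m))"
    by (rule mult_right_mono) simp
  also have "\<dots> = ?B * 4 ^ k * (((\<Sum>i\<le>m. (real ((k + i) choose i))\<^sup>2) * (fact k * (fact m)\<^sup>2 / fact (k + 2 * m))) / (fact m)\<^sup>2)"
    by (simp add: field_simps)
  also have "\<dots> \<le> ?B * 4 ^ k * ((2 - 1 / 2 ^ m) / (fact m)\<^sup>2)"
    by (intro mult_left_mono divide_right_mono sum_choose_sq_le mult_nonneg_nonneg sum_nonneg) auto
  finally show ?thesis .
qed

text \<open>
  The leading coefficient is kept apart as \<open>(b n)\<^sup>2\<close>, for which \<open>chebU_lead_coeff_le_sup\<close> has the better bound.
  In the other terms one of the two factors \<open>1 / fact m\<close> supplied by \<open>coeff_sq_le\<close> absorbs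
  \<open>2 - 1 / 2 ^ m\<close>, leaving the constant \<open>3 / 2\<close>, which is attained at \<open>m = 1\<close>; the other one makes the
  exponential series.
\<close>
lemma parity_sum_le:
  fixes lam :: real
  assumes "n \<le> N" "N \<le> Suc n"
  shows "(\<Sum>m\<le>n div 2. (coeff q (n - 2 * m))\<^sup>2 * (lam ^ (2 * m) * fact (n - 2 * m) / fact n))
     \<le> 4 ^ n * ((b n)\<^sup>2 + 3 / 2 * (\<Sum>j\<le>N. (b j)\<^sup>2) * (\<Sum>m\<in>{1..n div 2}. (lam\<^sup>2 / 16) ^ m / fact m))"
proof -
  let ?B = "\<Sum>j\<le>N. (b j)\<^sup>2"
  let ?t = "\<lambda>m. (coeff q (n - 2 * m))\<^sup>2 * (lam ^ (2 * m) * fact (n - 2 * m) / fact n)"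
  have t0: "?t 0 = 4 ^ n * (b n)\<^sup>2"
    using coeff_eq_sum_chebU[of n 0] assms by (simp add: lead_coeff_chebU power_mult_distrib square_power_two)
  have t: "?t m \<le> 4 ^ n * (3 / 2 * ?B * ((lam\<^sup>2 / 16) ^ m / fact m))" if "m \<in> {1..n div 2}" for m
  proof -
    define k where "k = n - 2 * m"
    have n: "n = k + 2 * m" using that unfolding k_def by auto
    have f: "(2 - 1 / 2 ^ m) / (fact m)\<^sup>2 \<le> (3 / 2) / (fact m :: real)"
    proof -
      have "2 - 1 / 2 ^ m \<le> 3 / 2 * (fact m :: real)"
      proof (cases "m = 1")
        case False
        then have "2 \<le> m" using that by auto
        then have "(2::real) \<le> fact m" using fact_mono[of 2 m, where ?'a = real] by (simp add: fact_2)
        moreover have "2 - 1 / 2 ^ m \<le> (2::real)" by simp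
        ultimately show ?thesis by linarith
      qed simp
      then show ?thesis by (simp add: divide_simps power2_eq_square mult_ac)
    qed
    have "?t m = lam ^ (2 * m) * ((coeff q k)\<^sup>2 * (fact k / fact (k + 2 * m)))"
      using n k_def by simp
    also have "\<dots> \<le> lam ^ (2 * m) * (?B * 4 ^ k * ((2 - 1 / 2 ^ m) / (fact m)\<^sup>2))"
      using assms n by (intro mult_left_mono coeff_sq_le) auto
    also have "\<dots> \<le> lam ^ (2 * m) * (?B * 4 ^ k * ((3 / 2) / fact m))"
      by (intro mult_left_mono f mult_nonneg_nonneg sum_nonneg) auto
    also have "\<dots> = 4 ^ n * (3 / 2 * ?B * ((lam\<^sup>2 / 16) ^ m / fact m))"
    proof -
      have "(4::real) ^ n = 4 ^ k * 16 ^ m" unfolding n by (simp add: power_add power_mult)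
      moreover have "lam ^ (2 * m) = (lam\<^sup>2) ^ m" by (simp only: power_mult)
      ultimately show ?thesis by (simp add: power_divide field_simps)
    qed
    finally show ?thesis .
  qed
  have "{..n div 2} = insert 0 {1..n div 2}" by auto
  then have "(\<Sum>m\<le>n div 2. ?t m) = ?t 0 + (\<Sum>m\<in>{1..n div 2}. ?t m)" by simp
  also have "\<dots> \<le> 4 ^ n * (b n)\<^sup>2 + (\<Sum>m\<in>{1..n div 2}. 4 ^ n * (3 / 2 * ?B * ((lam\<^sup>2 / 16) ^ m / fact m)))"
    unfolding t0 by (intro add_left_mono sum_mono t)
  also have "\<dots> = 4 ^ n * ((b n)\<^sup>2 + 3 / 2 * ?B * (\<Sum>m\<in>{1..n div 2}. (lam\<^sup>2 / 16) ^ m / fact m))"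
    by (simp add: sum_distrib_left distrib_left)
  finally show ?thesis .
qed

text \<open>
  The coefficients whose degree has the parity of \<open>N\<close> and those of the other parity are treated
  separately; for the second group \<open>fact N = N * fact (N - 1)\<close> produces the factor \<open>lam / N\<close>.
\<close>
lemma coeff_weighted_sum_le:
  fixes lam :: real
  assumes "N \<ge> 1" "0 \<le> lam"
  defines "B \<equiv> \<Sum>j\<le>N. (b j)\<^sup>2" and "R \<equiv> \<lambda>n. \<Sum>m\<in>{1..n div 2}. (lam\<^sup>2 / 16) ^ m / fact m"
  shows "(\<Sum>k\<le>N. (coeff q k)\<^sup>2 * (lam ^ (N - k) * fact k / fact N))
     \<le> 4 ^ N * ((b N)\<^sup>2 + 3 / 2 * B * R N + lam / (4 * N) * (B + 3 / 2 * B * R (N - 1)))"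
proof -
  let ?F = "\<lambda>j. (coeff q (N - j))\<^sup>2 * (lam ^ j * fact (N - j) / fact N)"
  have split: "(\<Sum>j\<le>n. F j) = (\<Sum>m\<le>n div 2. F (2 * m)) + (\<Sum>m<(n + 1) div 2. F (Suc (2 * m)))"
    for F :: "nat \<Rightarrow> real" and n
  proof (induction n)
    case (Suc n)
    show ?case
    proof (cases "even n")
      case True
      then obtain l where "n = 2 * l" by (elim evenE)
      then show ?thesis using Suc by simp
    next
      case False
      then obtain l where "n = 2 * l + 1" by (elim oddE)
      then show ?thesis using Suc by simp
    qed
  qed simp
  have "(\<Sum>k\<le>N. (coeff q k)\<^sup>2 * (lam ^ (N - k) * fact k / fact N)) = (\<Sum>j\<le>N. ?F j)"
    by (rule sum.reindex_bij_witness[of _ "\<lambda>j. N - j" "\<lambda>j. N - j"]) auto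
  also have "\<dots> = (\<Sum>m\<le>N div 2. ?F (2 * m)) + (\<Sum>m<(N + 1) div 2. ?F (Suc (2 * m)))"
    by (rule split)
  also have "(\<Sum>m<(N + 1) div 2. ?F (Suc (2 * m))) =
     lam / N * (\<Sum>m\<le>(N - 1) div 2. (coeff q (N - 1 - 2 * m))\<^sup>2 * (lam ^ (2 * m) * fact (N - 1 - 2 * m) / fact (N - 1)))"
  proof -
    have "{..<(N + 1) div 2} = {..(N - 1) div 2}" using assms(1) by auto
    moreover have "(fact N :: real) = N * fact (N - 1)" using assms(1) by (simp add: fact_reduce)
    ultimately show ?thesis by (simp add: sum_distrib_left mult_ac)
  qed
  also have "(\<Sum>m\<le>N div 2. ?F (2 * m)) \<le> 4 ^ N * ((b N)\<^sup>2 + 3 / 2 * B * R N)"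
    unfolding B_def R_def by (rule parity_sum_le) auto
  also have "lam / N * (\<Sum>m\<le>(N - 1) div 2. (coeff q (N - 1 - 2 * m))\<^sup>2 * (lam ^ (2 * m) * fact (N - 1 - 2 * m) / fact (N - 1)))
     \<le> lam / N * (4 ^ (N - 1) * ((b (N - 1))\<^sup>2 + 3 / 2 * B * R (N - 1)))"
    unfolding B_def R_def using assms(1,2) by (intro mult_left_mono parity_sum_le) auto
  also have "\<dots> \<le> lam / N * (4 ^ (N - 1) * (B + 3 / 2 * B * R (N - 1)))"
  proof -
    have "(b (N - 1))\<^sup>2 \<le> B" unfolding B_def by (rule member_le_sum) auto
    then show ?thesis using assms(2) by (intro mult_left_mono add_right_mono) auto
  qed
  also have "(4::real) ^ (N - 1) = 4 ^ N / 4" using assms(1) by (cases N) auto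
  finally show ?thesis by (simp add: algebra_simps)
qed

end

lemma sum_exp_le:
  fixes y :: real
  assumes "0 \<le> y"
  shows "(\<Sum>m\<in>{1..n}. y ^ m / fact m) \<le> exp y - 1"
proof -
  have "(\<Sum>m\<in>{..n}. y ^ m / fact m) \<le> exp y"
    using sum_le_suminf[OF summable_exp_generic[of y], of "{..n}"] assms
    by (simp add: exp_def field_simps)
  moreover have "{..n} = insert 0 {1..n}" by auto
  ultimately show ?thesis by simp
qed

text \<open>
  For \<open>s < 1\<close> this is \<open>1 - s \<le> 1 - s\<^sup>2 \<le> exp (- s\<^sup>2)\<close>.
\<close>
lemma exp_sq_minus_1_le:
  fixes s :: real
  assumes "0 \<le> s"
  shows "exp (s\<^sup>2) - 1 \<le> s * exp (s\<^sup>2)"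
proof (cases "s < 1")
  case True
  have "(1 - s) * exp (s\<^sup>2) \<le> exp (- s\<^sup>2) * exp (s\<^sup>2)"
  proof (rule mult_right_mono)
    have "s\<^sup>2 \<le> s" using True assms by (simp add: power2_eq_square mult_left_le)
    then show "1 - s \<le> exp (- s\<^sup>2)" using exp_ge_add_one_self[of "- s\<^sup>2"] by linarith
  qed simp
  then show ?thesis by (simp add: algebra_simps flip: exp_add)
next
  case False
  then have "1 * exp (s\<^sup>2) \<le> s * exp (s\<^sup>2)" by (intro mult_right_mono) auto
  then show ?thesis by linarith
qed

text \<open>
  With \<open>E = exp (lam\<^sup>2 / 16)\<close> the group of even distance to \<open>n\<close> contributes at most
  \<open>1 / 2 + 3 / 2 (E - 1) = E / 2 + (E - 1)\<close>, and \<open>exp_sq_minus_1_le\<close> at \<open>s = lam / 4\<close> bounds \<open>E - 1\<close> by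
  \<open>lam E / 4\<close>.  The other group contributes at most another \<open>lam E / 4\<close>, whence \<open>(1 + lam) / 2\<close>.
\<close>
lemma coeff_weighted_sum_le_sup:
  fixes q :: "real poly" and lam M :: real
  assumes "degree q \<le> n" "n \<ge> 1" "0 \<le> lam" "\<And>t. t \<in> {-1..1} \<Longrightarrow> \<bar>poly q t\<bar> \<le> M"
  shows "(\<Sum>k\<le>n. (coeff q k)\<^sup>2 * (lam ^ (n - k) * fact k / fact n))
     \<le> (1 + lam) / 2 * exp (lam\<^sup>2 / 16) * 4 ^ n * M\<^sup>2"
proof -
  obtain b where q: "q = (\<Sum>j\<le>n. smult (b j) (chebU j))"
    using chebU_expansion[OF assms(1)] by blast
  define B where "B = (\<Sum>j\<le>n. (b j)\<^sup>2)"
  define E where "E = exp (lam\<^sup>2 / 16)"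
  define R where "R = (\<lambda>n. \<Sum>m\<in>{1..n div 2}. (lam\<^sup>2 / 16) ^ m / fact m)"
  have R: "R n \<le> E - 1" for n unfolding R_def E_def by (rule sum_exp_le) simp
  have E: "E - 1 \<le> lam / 4 * E"
    using exp_sq_minus_1_le[of "lam / 4"] assms(3) by (simp add: E_def power_divide)
  have E1: "1 \<le> E" by (simp add: E_def)
  have B: "0 \<le> B" "B \<le> M\<^sup>2" "(b n)\<^sup>2 \<le> M\<^sup>2 / 2"
    using sum_chebU_coeffs_le_sup[OF q assms(4)] chebU_lead_coeff_le_sup[OF q assms(4,2)]
    by (auto simp: B_def intro: sum_nonneg)
  have R0: "0 \<le> R n" for n unfolding R_def by (intro sum_nonneg) auto
  \<comment> \<open>For \<open>n = 1\<close> the second group consists of the constant coefficient alone and \<open>R\<close> is an empty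
    sum; for larger \<open>n\<close> the factor \<open>1 / n\<close> compensates the constant \<open>3 / 2\<close>.\<close>
  have odd: "1 / (4 * n) * (1 + 3 / 2 * R (n - 1)) \<le> E / 4"
  proof (cases "n = 1")
    case True
    then show ?thesis using E1 by (simp add: R_def)
  next
    case False
    then have "1 / (4 * n) \<le> 1 / (8::real)" using assms(2) by (simp add: divide_simps)
    then have "1 / (4 * n) * (1 + 3 / 2 * R (n - 1)) \<le> 1 / 8 * (1 + 3 / 2 * (E - 1))"
      using R0 R by (intro mult_mono add_left_mono mult_left_mono) (auto simp: add_nonneg_nonneg)
    also have "\<dots> \<le> E / 4" using E1 by (simp add: field_simps)
    finally show ?thesis .
  qed
  have "(\<Sum>k\<le>n. (coeff q k)\<^sup>2 * (lam ^ (n - k) * fact k / fact n))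
     \<le> 4 ^ n * ((b n)\<^sup>2 + 3 / 2 * B * R n + lam / (4 * n) * (B + 3 / 2 * B * R (n - 1)))"
    unfolding B_def R_def by (rule coeff_weighted_sum_le[OF q assms(2,3)])
  also have "\<dots> = 4 ^ n * ((b n)\<^sup>2 + B * (3 / 2 * R n + lam * (1 / (4 * n) * (1 + 3 / 2 * R (n - 1)))))"
    by (simp add: field_simps)
  also have "\<dots> \<le> 4 ^ n * (M\<^sup>2 / 2 + M\<^sup>2 * (3 / 2 * (E - 1) + lam * (E / 4)))"
    using B R R0 odd assms(3) E1 by (intro mult_left_mono add_mono mult_mono) (auto intro!: mult_nonneg_nonneg)
  also have "\<dots> = 4 ^ n * M\<^sup>2 * (E / 2 + (E - 1) + lam / 4 * E)" by (simp add: field_simps)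
  also have "\<dots> \<le> 4 ^ n * M\<^sup>2 * (E / 2 + lam / 4 * E + lam / 4 * E)"
    using E by (intro mult_left_mono add_right_mono add_left_mono) auto
  also have "\<dots> = (1 + lam) / 2 * E * 4 ^ n * M\<^sup>2" by (simp add: field_simps)
  finally show ?thesis unfolding E_def .
qed

lemma coeff_weighted_sum_le_L2:
  fixes q :: "real poly" and lam :: real
  assumes "degree q \<le> n" "n \<ge> 1" "0 \<le> lam"
  shows "(\<Sum>k\<le>n. (coeff q k)\<^sup>2 * (lam ^ (n - k) * fact k / fact n))
     \<le> 3 / (4 * pi) * (4 + lam) * exp (lam\<^sup>2 / 16) * 4 ^ n * integral {-1..1} (\<lambda>t. (poly q t)\<^sup>2)"
proof -
  obtain b where q: "q = (\<Sum>j\<le>n. smult (b j) (chebU j))"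
    using chebU_expansion[OF assms(1)] by blast
  define B where "B = (\<Sum>j\<le>n. (b j)\<^sup>2)"
  define E where "E = exp (lam\<^sup>2 / 16)"
  define R where "R = (\<lambda>n. \<Sum>m\<in>{1..n div 2}. (lam\<^sup>2 / 16) ^ m / fact m)"
  have R: "R n \<le> E - 1" for n unfolding R_def E_def by (rule sum_exp_le) simp
  have R0: "0 \<le> R n" for n unfolding R_def by (intro sum_nonneg) auto
  have E1: "1 \<le> E" by (simp add: E_def)
  have B: "0 \<le> B" "(b n)\<^sup>2 \<le> B" unfolding B_def by (auto intro!: sum_nonneg member_le_sum)
  have "(\<Sum>k\<le>n. (coeff q k)\<^sup>2 * (lam ^ (n - k) * fact k / fact n))
     \<le> 4 ^ n * ((b n)\<^sup>2 + 3 / 2 * B * R n + lam / (4 * n) * (B + 3 / 2 * B * R (n - 1)))"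
    unfolding B_def R_def by (rule coeff_weighted_sum_le[OF q assms(2,3)])
  also have "\<dots> \<le> 4 ^ n * (B + 3 / 2 * B * (E - 1) + lam / 4 * (B + 3 / 2 * B * (E - 1)))"
    using B R R0 assms by (intro mult_left_mono add_mono mult_mono divide_left_mono) (auto intro!: add_nonneg_nonneg mult_nonneg_nonneg)
  also have "\<dots> = 4 ^ n * (B * (3 / 2 * E - 1 / 2) * (1 + lam / 4))" by (simp add: field_simps)
  also have "\<dots> \<le> 4 ^ n * (B * (3 / 2 * E) * (1 + lam / 4))"
    using B assms(3) by (intro mult_left_mono mult_right_mono) auto
  also have "\<dots> \<le> 4 ^ n * ((2 / pi * integral {-1..1} (\<lambda>t. (poly q t)\<^sup>2)) * (3 / 2 * E) * (1 + lam / 4))"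
    using sum_chebU_coeffs_le_L2[OF q] assms(3) E1 unfolding B_def
    by (intro mult_left_mono mult_right_mono) auto
  also have "\<dots> = 3 / (4 * pi) * (4 + lam) * E * 4 ^ n * integral {-1..1} (\<lambda>t. (poly q t)\<^sup>2)"
    by (simp add: field_simps)
  finally show ?thesis unfolding E_def .
qed


section \<open>Fourier inversion and Plancherel's inequality\<close>

text \<open>
  Without the factor \<open>1 / sqrt (2 * pi)\<close> and for complex-valued functions, so that transforms can be
  transformed again.
\<close>
definition FT :: "(real \<Rightarrow> complex) \<Rightarrow> real \<Rightarrow> complex" where
  "FT h \<omega> = (CLINT x|lborel. h x * iexp (x * \<omega>))"

lemma fourier_eq_FT: "fourier f \<omega> = of_real (1 / sqrt (2 * pi)) * FT (\<lambda>x. of_real (f x)) \<omega>"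
  by (simp add: fourier_def FT_def)

lemma integrable_mult_iexp:
  assumes "integrable lborel (h :: real \<Rightarrow> complex)"
  shows "integrable lborel (\<lambda>x. h x * iexp (x * \<omega>))"
  using assms by (rule Bochner_Integration.integrable_bound) (use assms in \<open>auto simp: norm_mult\<close>)

lemma FT_measurable [measurable]:
  assumes [measurable]: "h \<in> borel_measurable lborel"
  shows "FT h \<in> borel_measurable lborel"
  unfolding FT_def by measurable

lemma norm_FT_le: "norm (FT h \<omega>) \<le> (\<integral>x. norm (h x) \<partial>lborel)"
proof -
  have "norm (FT h \<omega>) \<le> (\<integral>x. norm (h x * iexp (x * \<omega>)) \<partial>lborel)"
    unfolding FT_def by (rule integral_norm_bound)
  then show ?thesis by (simp add: norm_mult)
qed

lemma FT_sum:
  assumes "finite I" "\<And>i. i \<in> I \<Longrightarrow> integrable lborel (h i)"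
  shows "FT (\<lambda>x. \<Sum>i\<in>I. h i x) \<omega> = (\<Sum>i\<in>I. FT (h i) \<omega>)"
  unfolding FT_def sum_distrib_right
  using assms by (intro Bochner_Integration.integral_sum integrable_mult_iexp)

lemma FT_cmult: "FT (\<lambda>x. c * h x) \<omega> = c * FT h \<omega>"
  unfolding FT_def by (simp add: mult.assoc)

lemma FT_diff:
  assumes "integrable lborel f" "integrable lborel g"
  shows "FT (\<lambda>x. f x - g x) \<omega> = FT f \<omega> - FT g \<omega>"
  unfolding FT_def left_diff_distrib
  using assms by (intro Bochner_Integration.integral_diff integrable_mult_iexp)

lemma FT_reflect: "FT (\<lambda>x. h (- x)) \<omega> = FT h (- \<omega>)"
  unfolding FT_def by (subst lborel_integral_real_affine[of "-1" _ 0]) auto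

lemma integrable_std_normal [simp]: "integrable lborel std_normal_density"
  using integrable_std_normal_moment[of 0] by simp

lemma integral_std_normal [simp]: "(\<integral>x. std_normal_density x \<partial>lborel) = 1"
  using integral_std_normal_moment_even[of 0] by simp

lemma FT_std_normal: "FT (\<lambda>x. of_real (std_normal_density x)) t = of_real (sqrt (2 * pi) * std_normal_density t)"
proof -
  have "char std_normal_distribution t = (CLINT x|lborel. std_normal_density x *\<^sub>R iexp (t * x))"
    unfolding char_def by (subst integral_density) auto
  also have "\<dots> = FT (\<lambda>x. of_real (std_normal_density x)) t"
    unfolding FT_def by (simp add: scaleR_conv_of_real mult.commute)
  finally have "FT (\<lambda>x. of_real (std_normal_density x)) t = of_real (exp (- (t\<^sup>2) / 2))"
    unfolding char_std_normal_distribution by (rule sym)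
  moreover have "exp (- (t\<^sup>2) / 2) = sqrt (2 * pi) * std_normal_density t"
    by (simp add: std_normal_density_def)
  ultimately show ?thesis by (simp only:)
qed

lemma FT_std_normal_scaled:
  assumes "0 < e"
  shows "FT (\<lambda>x. of_real (std_normal_density (e * x))) t
    = of_real (sqrt (2 * pi) / e * std_normal_density (t / e))"
proof -
  have "FT (\<lambda>x. of_real (std_normal_density (e * x))) t = (1 / e) *\<^sub>R FT (\<lambda>x. of_real (std_normal_density x)) (t / e)"
    unfolding FT_def using assms
    by (subst lborel_integral_real_affine[of "1 / e" _ 0]) (simp_all add: mult.commute)
  then show ?thesis using assms by (simp add: FT_std_normal scaleR_conv_of_real)
qed

lemma integrable_scaled:
  fixes f :: "real \<Rightarrow> 'a::{banach, second_countable_topology}"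
  assumes "integrable lborel f" "e \<noteq> 0"
  shows "integrable lborel (\<lambda>x. f (e * x))"
  using lborel_integrable_real_affine[OF assms, of 0] by simp

lemma integrable_pair_mult:
  fixes f g :: "real \<Rightarrow> complex"
  assumes "integrable lborel f" "integrable lborel g"
  shows "integrable (lborel \<Otimes>\<^sub>M lborel) (\<lambda>(x, y). f x * g y)"
proof (rule lborel_pair.Fubini_integrable)
  have [measurable]: "f \<in> borel_measurable lborel" "g \<in> borel_measurable lborel" using assms by auto
  show "(\<lambda>(x, y). f x * g y) \<in> borel_measurable (lborel \<Otimes>\<^sub>M lborel)" by measurable
qed (use assms in \<open>auto simp: norm_mult\<close>)

text \<open>
  Inserting the Gaussian makes the double integral absolutely convergent.  Exchanging the order of
  integration replaces it by its own transform, so that the damped inverse transform of \<open>FT h\<close> is an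
  average of \<open>h\<close> against a Gaussian of width \<open>e\<close> centred at \<open>x\<close>.
\<close>
lemma gaussian_smoothed_inversion:
  fixes h :: "real \<Rightarrow> complex"
  assumes h: "integrable lborel h" and e: "0 < e"
  shows "(CLINT w|lborel. FT h w * of_real (std_normal_density (e * w)) * iexp (- (x * w)))
     = of_real (sqrt (2 * pi)) * (CLINT z|lborel. h (x + e * z) * of_real (std_normal_density z))"
proof -
  have [measurable]: "h \<in> borel_measurable lborel" using h by auto
  have g: "integrable lborel (\<lambda>w. of_real (std_normal_density (e * w)) :: complex)"
    using integrable_scaled[OF integrable_std_normal, of e] e by simp
  let ?f = "\<lambda>w y. of_real (std_normal_density (e * w)) * h y * iexp (w * (y - x))"
  have "integrable (lborel \<Otimes>\<^sub>M lborel) (case_prod ?f)"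
    using integrable_pair_mult[OF g h]
    by (rule Bochner_Integration.integrable_bound) (auto simp: norm_mult split_beta)
  note fub = lborel_pair.Fubini_integral[OF this]
  have "(CLINT w|lborel. FT h w * of_real (std_normal_density (e * w)) * iexp (- (x * w)))
      = (CLINT w|lborel. CLINT y|lborel. ?f w y)"
  proof (rule Bochner_Integration.integral_cong[OF refl])
    fix w
    have "FT h w * of_real (std_normal_density (e * w)) * iexp (- (x * w))
       = (of_real (std_normal_density (e * w)) * iexp (- (x * w))) * (CLINT y|lborel. h y * iexp (y * w))"
      unfolding FT_def by simp
    also have "\<dots> = (CLINT y|lborel. (of_real (std_normal_density (e * w)) * iexp (- (x * w))) * (h y * iexp (y * w)))"
      by simp
    also have "\<dots> = (CLINT y|lborel. ?f w y)"
    proof (rule Bochner_Integration.integral_cong[OF refl])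
      fix y
      have "iexp (w * (y - x)) = iexp (- (x * w)) * iexp (y * w)"
        by (simp add: algebra_simps flip: exp_add)
      then show "(of_real (std_normal_density (e * w)) * iexp (- (x * w))) * (h y * iexp (y * w)) = ?f w y"
        by (simp add: mult_ac)
    qed
    finally show "FT h w * of_real (std_normal_density (e * w)) * iexp (- (x * w)) = (CLINT y|lborel. ?f w y)" .
  qed
  also have "\<dots> = (CLINT y|lborel. CLINT w|lborel. ?f w y)" by (rule fub[symmetric])
  also have "\<dots> = (CLINT y|lborel. h y * of_real (sqrt (2 * pi) / e * std_normal_density ((y - x) / e)))"
  proof (rule Bochner_Integration.integral_cong[OF refl])
    fix y
    have "(CLINT w|lborel. ?f w y) = h y * FT (\<lambda>w. of_real (std_normal_density (e * w))) (y - x)"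
      unfolding FT_def integral_mult_right_zero[symmetric] by (simp only: mult_ac)
    then show "(CLINT w|lborel. ?f w y) = h y * of_real (sqrt (2 * pi) / e * std_normal_density ((y - x) / e))"
      using FT_std_normal_scaled[OF e] by simp
  qed
  also have "\<dots> = e *\<^sub>R (CLINT z|lborel. h (x + e * z) * of_real (sqrt (2 * pi) / e * std_normal_density z))"
    using e by (subst lborel_integral_real_affine[of e _ x]) auto
  also have "(\<lambda>z. h (x + e * z) * of_real (sqrt (2 * pi) / e * std_normal_density z))
     = (\<lambda>z. of_real (sqrt (2 * pi) / e) * (h (x + e * z) * of_real (std_normal_density z)))"
    by (auto simp: mult_ac)
  finally show ?thesis using e by (simp add: scaleR_conv_of_real)
qed

lemma std_normal_density_le: "std_normal_density x \<le> std_normal_density 0"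
  by (simp add: std_normal_density_def divide_right_mono)

lemma inverse_Suc_mult_tendsto_0: "(\<lambda>n. 1 / real (Suc n) * w) \<longlonglongrightarrow> 0"
  unfolding inverse_eq_divide[symmetric] by (rule tendsto_mult_left_zero[OF LIMSEQ_inverse_real_of_nat])

lemma std_normal_density_scaled_tendsto:
  "(\<lambda>n. std_normal_density (1 / real (Suc n) * w)) \<longlonglongrightarrow> std_normal_density 0"
proof -
  have "(\<lambda>n. exp (- (1 / real (Suc n) * w)\<^sup>2 / 2)) \<longlonglongrightarrow> exp (- 0\<^sup>2 / 2)"
    by (intro tendsto_intros inverse_Suc_mult_tendsto_0) auto
  then show ?thesis unfolding std_normal_density_def by (intro tendsto_mult tendsto_const) simp
qed

text \<open>
  Let the width tend to \<open>0\<close> in \<open>gaussian_smoothed_inversion\<close>: dominated convergence applies on the left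
  because \<open>FT h\<close> is integrable and on the right because \<open>h\<close> is bounded and continuous.
\<close>
lemma fourier_inversion:
  fixes h :: "real \<Rightarrow> complex"
  assumes int: "integrable lborel h" and intF: "integrable lborel (FT h)"
    and cont: "continuous_on UNIV h" and bdd: "\<And>x. norm (h x) \<le> C"
  shows "(CLINT w|lborel. FT h w * iexp (- (x * w))) = of_real (2 * pi) * h x"
proof -
  have [measurable]: "h \<in> borel_measurable lborel" using int by auto
  let ?e = "\<lambda>n. 1 / real (Suc n)"
  have lim1: "(\<lambda>n. CLINT w|lborel. FT h w * of_real (std_normal_density (?e n * w)) * iexp (- (x * w)))
     \<longlonglongrightarrow> (CLINT w|lborel. FT h w * of_real (std_normal_density 0) * iexp (- (x * w)))"
  proof (rule integral_dominated_convergence[where w = "\<lambda>w. norm (FT h w) * std_normal_density 0"])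
    show "AE w in lborel. (\<lambda>n. FT h w * of_real (std_normal_density (?e n * w)) * iexp (- (x * w)))
        \<longlonglongrightarrow> FT h w * of_real (std_normal_density 0) * iexp (- (x * w))"
      by (intro AE_I2 tendsto_mult tendsto_const tendsto_of_real std_normal_density_scaled_tendsto)
    show "AE w in lborel. norm (FT h w * of_real (std_normal_density (?e n * w)) * iexp (- (x * w)))
        \<le> norm (FT h w) * std_normal_density 0" for n
      by (auto simp: norm_mult intro!: mult_left_mono std_normal_density_le)
    show "integrable lborel (\<lambda>w. norm (FT h w) * std_normal_density 0)"
      using intF by simp
  qed measurable
  have lim2: "(\<lambda>n. of_real (sqrt (2 * pi)) * (CLINT z|lborel. h (x + ?e n * z) * of_real (std_normal_density z)))
     \<longlonglongrightarrow> of_real (sqrt (2 * pi)) * (CLINT z|lborel. h x * of_real (std_normal_density z))"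
  proof (intro tendsto_mult tendsto_const integral_dominated_convergence[where w = "\<lambda>z. C * std_normal_density z"])
    show "AE z in lborel. (\<lambda>n. h (x + ?e n * z) * of_real (std_normal_density z)) \<longlonglongrightarrow> h x * of_real (std_normal_density z)"
    proof (intro AE_I2 tendsto_mult tendsto_const)
      fix z
      have "(\<lambda>n. x + ?e n * z) \<longlonglongrightarrow> x + 0"
        by (intro tendsto_add tendsto_const inverse_Suc_mult_tendsto_0)
      then show "(\<lambda>n. h (x + ?e n * z)) \<longlonglongrightarrow> h x"
        using continuous_on_tendsto_compose[OF cont] by simp
    qed
    show "AE z in lborel. norm (h (x + ?e n * z) * of_real (std_normal_density z)) \<le> C * std_normal_density z" for n
      using bdd by (auto simp: norm_mult intro!: mult_right_mono)
  qed auto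
  have eq: "(CLINT w|lborel. FT h w * of_real (std_normal_density (?e n * w)) * iexp (- (x * w)))
     = of_real (sqrt (2 * pi)) * (CLINT z|lborel. h (x + ?e n * z) * of_real (std_normal_density z))" for n
    by (rule gaussian_smoothed_inversion[OF int]) simp
  have "of_real (std_normal_density 0) * (CLINT w|lborel. FT h w * iexp (- (x * w)))
     = (CLINT w|lborel. FT h w * of_real (std_normal_density 0) * iexp (- (x * w)))"
    unfolding integral_mult_right_zero[symmetric] by (simp only: mult_ac)
  also have "\<dots> = of_real (sqrt (2 * pi)) * (CLINT z|lborel. h x * of_real (std_normal_density z))"
    by (rule LIMSEQ_unique[OF lim1[unfolded eq] lim2])
  also have "(CLINT z|lborel. h x * of_real (std_normal_density z)) = h x"
    by simp
  finally have "of_real (sqrt (2 * pi) * std_normal_density 0) * (CLINT w|lborel. FT h w * iexp (- (x * w)))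
     = of_real (sqrt (2 * pi) * sqrt (2 * pi)) * h x"
    by (simp only: of_real_mult mult.assoc)
  then show ?thesis by (simp add: std_normal_density_def)
qed

text \<open>
  Writing the square as \<open>FT h * cnj (FT h)\<close> and unfolding the second factor, the inner integral is the
  Gaussian average of \<open>h\<close> from \<open>gaussian_smoothed_inversion\<close>.  The integral becomes
  \<open>cnj (h y) * h (y + e z)\<close> against a probability density in \<open>z\<close>, and the inequality between geometric and
  arithmetic mean together with translation invariance bounds it by the integral of \<open>(norm h)\<^sup>2\<close>.
\<close>
lemma FT_weighted_L2_le:
  fixes h :: "real \<Rightarrow> complex"
  assumes h: "integrable lborel h" and e: "0 < e"
  shows "(\<integral>\<^sup>+w. ennreal ((norm (FT h w))\<^sup>2 * std_normal_density (e * w)) \<partial>lborel)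
     \<le> ennreal (sqrt (2 * pi)) * (\<integral>\<^sup>+x. ennreal ((norm (h x))\<^sup>2) \<partial>lborel)"
proof -
  have [measurable]: "h \<in> borel_measurable borel" "FT h \<in> borel_measurable borel"
    using h FT_measurable[of h] by auto
  have [measurable]: "cnj \<in> borel_measurable borel"
    by (intro borel_measurable_continuous_onI continuous_intros)
  define A where "A = (\<integral>\<^sup>+x. ennreal ((norm (h x))\<^sup>2) \<partial>lborel)"
  define I where "I = (\<integral>w. (norm (FT h w))\<^sup>2 * std_normal_density (e * w) \<partial>lborel)"
  let ?M = "\<integral>x. norm (h x) \<partial>lborel"
  define half :: real where "half = 1 / 2"
  have int_g: "integrable lborel (\<lambda>w. std_normal_density (e * w))"
    using integrable_scaled[OF integrable_std_normal, of e] e by simp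
  have int: "integrable lborel (\<lambda>w. (norm (FT h w))\<^sup>2 * std_normal_density (e * w))"
  proof (rule Bochner_Integration.integrable_bound[OF integrable_mult_right[OF int_g, of "?M\<^sup>2"]])
    show "AE w in lborel. norm ((norm (FT h w))\<^sup>2 * std_normal_density (e * w)) \<le> norm (?M\<^sup>2 * std_normal_density (e * w))"
      using norm_FT_le by (auto simp: abs_mult intro!: mult_right_mono power_mono)
  qed measurable
  have "of_real I = (CLINT w|lborel. of_real ((norm (FT h w))\<^sup>2 * std_normal_density (e * w)))"
    unfolding I_def by (rule integral_complex_of_real[symmetric])
  also have "\<dots> = (CLINT w|lborel. CLINT y|lborel. cnj (h y) * (FT h w * of_real (std_normal_density (e * w)) * iexp (- (y * w))))"
  proof (rule Bochner_Integration.integral_cong[OF refl])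
    fix w
    have "cnj (FT h w) = (CLINT y|lborel. cnj (h y * iexp (y * w)))"
      unfolding FT_def by (rule Bochner_Integration.integral_cnj[symmetric])
    also have "\<dots> = (CLINT y|lborel. cnj (h y) * iexp (- (y * w)))"
      by (simp add: exp_cnj)
    finally have c: "cnj (FT h w) = (CLINT y|lborel. cnj (h y) * iexp (- (y * w)))" .
    have "(of_real ((norm (FT h w))\<^sup>2 * std_normal_density (e * w)) :: complex) =
        (FT h w * of_real (std_normal_density (e * w))) * cnj (FT h w)"
      by (simp add: complex_norm_square mult_ac flip: of_real_power)
    also have "\<dots> = (CLINT y|lborel. (FT h w * of_real (std_normal_density (e * w))) * (cnj (h y) * iexp (- (y * w))))"
      unfolding c by simp
    finally show "(of_real ((norm (FT h w))\<^sup>2 * std_normal_density (e * w)) :: complex)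
      = (CLINT y|lborel. cnj (h y) * (FT h w * of_real (std_normal_density (e * w)) * iexp (- (y * w))))"
      by (simp only: mult_ac)
  qed
  also have "\<dots> = (CLINT y|lborel. CLINT w|lborel. cnj (h y) * (FT h w * of_real (std_normal_density (e * w)) * iexp (- (y * w))))"
  proof (rule lborel_pair.Fubini_integral[symmetric])
    have "integrable lborel (\<lambda>w. FT h w * of_real (std_normal_density (e * w)))"
    proof (rule Bochner_Integration.integrable_bound[OF integrable_mult_right[OF int_g, of "?M"]])
      show "AE w in lborel. norm (FT h w * of_real (std_normal_density (e * w))) \<le> norm (?M * std_normal_density (e * w))"
        using norm_FT_le by (auto simp: norm_mult abs_mult intro!: mult_right_mono)
    qed measurable
    from integrable_pair_mult[OF this, of "\<lambda>y. cnj (h y)"]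
    have "integrable (lborel \<Otimes>\<^sub>M lborel) (\<lambda>(w, y). (FT h w * of_real (std_normal_density (e * w))) * cnj (h y))"
      using h by simp
    then show "integrable (lborel \<Otimes>\<^sub>M lborel) (\<lambda>(w, y). cnj (h y) * (FT h w * of_real (std_normal_density (e * w)) * iexp (- (y * w))))"
      by (rule Bochner_Integration.integrable_bound) (auto simp: norm_mult split_beta mult_ac)
  qed
  also have "\<dots> = (CLINT y|lborel. cnj (h y) * (of_real (sqrt (2 * pi)) * (CLINT z|lborel. h (y + e * z) * of_real (std_normal_density z))))"
    by (simp only: integral_mult_right_zero gaussian_smoothed_inversion[OF h e])
  also have "\<dots> = of_real (sqrt (2 * pi)) * (CLINT y|lborel. CLINT z|lborel. cnj (h y) * (h (y + e * z) * of_real (std_normal_density z)))"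
    unfolding integral_mult_right_zero[symmetric] by (simp only: mult_ac)
  finally have I: "norm (of_real I :: complex) = sqrt (2 * pi) * norm (CLINT y|lborel. CLINT z|lborel. cnj (h y) * (h (y + e * z) * of_real (std_normal_density z)))"
    by (simp add: norm_mult)
  have norm_le: "ennreal (norm (integral\<^sup>L M f)) \<le> (\<integral>\<^sup>+x. ennreal (norm (f x)) \<partial>M)" for M :: "real measure" and f :: "real \<Rightarrow> complex"
    by (cases "integrable M f") (auto simp: integral_norm_bound_ennreal not_integrable_integral_eq)
  have "ennreal (norm (CLINT y|lborel. CLINT z|lborel. cnj (h y) * (h (y + e * z) * of_real (std_normal_density z))))
     \<le> (\<integral>\<^sup>+y. ennreal (norm (CLINT z|lborel. cnj (h y) * (h (y + e * z) * of_real (std_normal_density z)))) \<partial>lborel)"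
    by (rule norm_le)
  also have "\<dots> \<le> (\<integral>\<^sup>+y. \<integral>\<^sup>+z. ennreal (norm (cnj (h y) * (h (y + e * z) * of_real (std_normal_density z)))) \<partial>lborel \<partial>lborel)"
    by (intro nn_integral_mono norm_le)
  also have "\<dots> \<le> (\<integral>\<^sup>+y. \<integral>\<^sup>+z. ennreal (std_normal_density z) * ((ennreal ((norm (h y))\<^sup>2) + ennreal ((norm (h (y + e * z)))\<^sup>2)) * ennreal half) \<partial>lborel \<partial>lborel)"
  proof (intro nn_integral_mono)
    fix y z
    have "norm (h y) * norm (h (y + e * z)) \<le> ((norm (h y))\<^sup>2 + (norm (h (y + e * z)))\<^sup>2) * half"
      using sum_squares_bound[of "norm (h y)" "norm (h (y + e * z))"] by (simp add: half_def)
    from mult_left_mono[OF this, of "std_normal_density z"]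
    have "norm (cnj (h y) * (h (y + e * z) * of_real (std_normal_density z)))
       \<le> std_normal_density z * (((norm (h y))\<^sup>2 + (norm (h (y + e * z)))\<^sup>2) * half)"
      by (simp add: norm_mult mult_ac)
    moreover have "0 \<le> half" by (simp add: half_def)
    ultimately show "ennreal (norm (cnj (h y) * (h (y + e * z) * of_real (std_normal_density z))))
       \<le> ennreal (std_normal_density z) * ((ennreal ((norm (h y))\<^sup>2) + ennreal ((norm (h (y + e * z)))\<^sup>2)) * ennreal half)"
      by (simp flip: ennreal_plus ennreal_mult)
  qed
  also have "\<dots> = (\<integral>\<^sup>+z. \<integral>\<^sup>+y. ennreal (std_normal_density z) * ((ennreal ((norm (h y))\<^sup>2) + ennreal ((norm (h (y + e * z)))\<^sup>2)) * ennreal half) \<partial>lborel \<partial>lborel)"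
    by (rule lborel_pair.Fubini') measurable
  also have "\<dots> = (\<integral>\<^sup>+z. ennreal (std_normal_density z) * A \<partial>lborel)"
  proof (rule nn_integral_cong)
    fix z
    have "(\<integral>\<^sup>+y. ennreal ((norm (h (y + e * z)))\<^sup>2) \<partial>lborel) = A"
      unfolding A_def by (subst (2) nn_integral_real_affine[of _ 1 "e * z"]) (auto simp: add.commute)
    moreover have "(A + A) * ennreal half = A"
    proof -
      have "A + A = A * ennreal 2" by (simp add: mult_2_right)
      moreover have "ennreal 2 * ennreal half = ennreal (2 * half)"
        by (rule ennreal_mult[symmetric]) (auto simp: half_def)
      ultimately show ?thesis by (simp add: half_def mult.assoc del: ennreal_numeral)
    qed
    ultimately show "(\<integral>\<^sup>+y. ennreal (std_normal_density z) * ((ennreal ((norm (h y))\<^sup>2) + ennreal ((norm (h (y + e * z)))\<^sup>2)) * ennreal half) \<partial>lborel)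
      = ennreal (std_normal_density z) * A"
      by (simp add: nn_integral_cmult nn_integral_multc nn_integral_add A_def)
  qed
  also have "\<dots> = A"
    by (simp add: nn_integral_multc nn_integral_eq_integral)
  finally have "ennreal (norm (CLINT y|lborel. CLINT z|lborel. cnj (h y) * (h (y + e * z) * of_real (std_normal_density z)))) \<le> A" .
  then have "ennreal (norm (of_real I :: complex)) \<le> ennreal (sqrt (2 * pi)) * A"
    unfolding I by (simp add: ennreal_mult mult_left_mono)
  moreover have "(\<integral>\<^sup>+w. ennreal ((norm (FT h w))\<^sup>2 * std_normal_density (e * w)) \<partial>lborel) = ennreal I"
    unfolding I_def by (rule nn_integral_eq_integral[OF int]) simp
  moreover have "0 \<le> I" unfolding I_def by simp
  ultimately show ?thesis unfolding A_def by simp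
qed

text \<open>
  Plancherel's theorem with \<open>\<le>\<close> in place of equality, by Fatou's lemma applied to the Gaussian-weighted
  version as the width of the weight tends to infinity.
\<close>
lemma FT_L2_le:
  fixes h :: "real \<Rightarrow> complex"
  assumes h: "integrable lborel h"
  shows "(\<integral>\<^sup>+w. ennreal ((norm (FT h w))\<^sup>2) \<partial>lborel) \<le> ennreal (2 * pi) * (\<integral>\<^sup>+x. ennreal ((norm (h x))\<^sup>2) \<partial>lborel)"
proof -
  have [measurable]: "h \<in> borel_measurable lborel" using h by auto
  let ?e = "\<lambda>n. 1 / real (Suc n)"
  let ?f = "\<lambda>n w. ennreal ((norm (FT h w))\<^sup>2 * std_normal_density (?e n * w))"
  let ?A = "\<integral>\<^sup>+x. ennreal ((norm (h x))\<^sup>2) \<partial>lborel"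
  have "(\<integral>\<^sup>+w. ennreal ((norm (FT h w))\<^sup>2 * std_normal_density 0) \<partial>lborel) = (\<integral>\<^sup>+w. liminf (\<lambda>n. ?f n w) \<partial>lborel)"
  proof (rule nn_integral_cong)
    fix w
    have "(\<lambda>n. ?f n w) \<longlonglongrightarrow> ennreal ((norm (FT h w))\<^sup>2 * std_normal_density 0)"
      by (intro tendsto_ennrealI tendsto_mult tendsto_const std_normal_density_scaled_tendsto)
    then show "ennreal ((norm (FT h w))\<^sup>2 * std_normal_density 0) = liminf (\<lambda>n. ?f n w)"
      by (intro lim_imp_Liminf[symmetric]) simp_all
  qed
  also have "\<dots> \<le> liminf (\<lambda>n. \<integral>\<^sup>+w. ?f n w \<partial>lborel)"
    by (rule nn_integral_liminf) measurable
  also have "\<dots> \<le> ennreal (sqrt (2 * pi)) * ?A"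
    by (intro Liminf_le always_eventually allI FT_weighted_L2_le[OF h]) simp_all
  finally have *: "(\<integral>\<^sup>+w. ennreal ((norm (FT h w))\<^sup>2 * std_normal_density 0) \<partial>lborel) \<le> ennreal (sqrt (2 * pi)) * ?A" .
  have "(\<integral>\<^sup>+w. ennreal ((norm (FT h w))\<^sup>2) \<partial>lborel) = (\<integral>\<^sup>+w. ennreal (sqrt (2 * pi)) * ennreal ((norm (FT h w))\<^sup>2 * std_normal_density 0) \<partial>lborel)"
    by (intro nn_integral_cong) (simp add: std_normal_density_def flip: ennreal_mult)
  also have "\<dots> = ennreal (sqrt (2 * pi)) * (\<integral>\<^sup>+w. ennreal ((norm (FT h w))\<^sup>2 * std_normal_density 0) \<partial>lborel)"
    by (rule nn_integral_cmult) measurable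
  also have "\<dots> \<le> ennreal (sqrt (2 * pi)) * (ennreal (sqrt (2 * pi)) * ?A)"
    by (intro mult_left_mono *) simp
  also have "\<dots> = ennreal (2 * pi) * ?A"
    by (simp add: mult.assoc[symmetric] flip: ennreal_mult)
  finally show ?thesis .
qed


section \<open>Functions whose transform has integrable derivatives\<close>

text \<open>
  The integral of \<open>h' (w + s)\<close> over \<open>0 \<le> s \<le> 1\<close> and all \<open>w\<close> is computed in both orders: it is the integral of
  \<open>h'\<close>, and it is the integral of \<open>h (w + 1) - h w\<close>, which vanishes by translation invariance.  This
  avoids any discussion of limits of \<open>h\<close> at infinity.
\<close>
lemma integral_derivative_eq_0:
  fixes h h' :: "real \<Rightarrow> complex"
  assumes deriv: "\<And>x. (h has_vector_derivative h' x) (at x)" and cont: "continuous_on UNIV h'"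
    and h: "integrable lborel h" and h': "integrable lborel h'"
  shows "(CLINT x|lborel. h' x) = 0"
proof -
  have [measurable]: "h' \<in> borel_measurable borel" using h' by auto
  let ?f = "\<lambda>w s. indicator {0..1::real} s *\<^sub>R h' (w + s)"
  have "integrable (lborel \<Otimes>\<^sub>M lborel) (\<lambda>(s, w). ?f w s)"
  proof (rule lborel_pair.Fubini_integrable)
    have "(\<integral>w. norm (?f w s) \<partial>lborel) = indicator {0..1} s * (\<integral>w. norm (h' w) \<partial>lborel)" for s
      by (subst (2) lborel_integral_real_affine[of 1 _ s]) (auto simp: add.commute)
    then show "integrable lborel (\<lambda>s. \<integral>w. norm (case (s, w) of (s, w) \<Rightarrow> ?f w s) \<partial>lborel)"
      unfolding prod.case by (simp only:) simp
    show "AE s in lborel. integrable lborel (\<lambda>w. case (s, w) of (s, w) \<Rightarrow> ?f w s)"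
      using lborel_integrable_real_affine[OF h', of 1] by (simp add: add.commute)
  qed measurable
  from lborel_pair.Fubini_integral[OF this]
  have "(CLINT w|lborel. CLINT s|lborel. ?f w s) = (CLINT s|lborel. CLINT w|lborel. ?f w s)" .
  also have "(CLINT w|lborel. CLINT s|lborel. ?f w s) = (CLINT w|lborel. h (1 + w) - h w)"
  proof (rule Bochner_Integration.integral_cong[OF refl])
    fix w
    have "(CLINT s|lborel. ?f w s) = h (w + 1) - h (w + 0)"
    proof (rule integral_FTC_Icc)
      fix s :: real
      have "((\<lambda>s. h (w + s)) has_vector_derivative h' (w + s)) (at s)"
      proof -
        have "((\<lambda>s. w + s) has_vector_derivative 1) (at s)"
          by (auto intro!: derivative_eq_intros)
        from vector_diff_chain_at[OF this deriv] show ?thesis by (simp add: o_def)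
      qed
      then show "((\<lambda>s. h (w + s)) has_vector_derivative h' (w + s)) (at s within {0..1})"
        by (rule has_vector_derivative_at_within)
      show "continuous_on {0..1} (\<lambda>s. h' (w + s))"
        by (intro continuous_on_compose2[OF cont] continuous_intros) auto
    qed simp
    then show "(CLINT s|lborel. ?f w s) = h (1 + w) - h w" by (simp add: add.commute)
  qed
  also have "\<dots> = (CLINT w|lborel. h (1 + w)) - (CLINT w|lborel. h w)"
    using lborel_integrable_real_affine[OF h, of 1 1] h by (intro Bochner_Integration.integral_diff) auto
  also have "\<dots> = 0"
    using lborel_integral_real_affine[of 1 h 1] by simp
  also have "(CLINT s|lborel. CLINT w|lborel. ?f w s) = (CLINT s|lborel. indicator {0..1::real} s *\<^sub>R (CLINT w|lborel. h' w))"
  proof (rule Bochner_Integration.integral_cong[OF refl])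
    fix s :: real
    show "(CLINT w|lborel. ?f w s) = indicator {0..1::real} s *\<^sub>R (CLINT w|lborel. h' w)"
      by (subst (2) lborel_integral_real_affine[of 1 _ s]) (auto simp: add.commute)
  qed
  also have "\<dots> = (CLINT w|lborel. h' w)" by simp
  finally show ?thesis by simp
qed

lemma FT_derivative:
  fixes D D' :: "real \<Rightarrow> real"
  assumes deriv: "\<And>x. (D has_real_derivative D' x) (at x)" and cont: "continuous_on UNIV D'"
    and D: "integrable lborel D" and D': "integrable lborel D'"
  shows "FT (\<lambda>x. of_real (D' x)) t = - (\<i> * t) * FT (\<lambda>x. of_real (D x)) t"
proof -
  let ?h = "\<lambda>x. of_real (D x) * iexp (x * t)"
  let ?h1 = "\<lambda>x. of_real (D' x) * iexp (x * t)"
  let ?h2 = "\<lambda>x. (\<i> * t) * (of_real (D x) * iexp (x * t))"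
  have continuous_D: "continuous_on UNIV D"
    using deriv by (meson DERIV_isCont continuous_at_imp_continuous_on)
  have int: "integrable lborel ?h" "integrable lborel ?h1" "integrable lborel ?h2"
    using integrable_mult_iexp[of "\<lambda>x. of_real (D x)" t] integrable_mult_iexp[of "\<lambda>x. of_real (D' x)" t] D D'
    by auto
  have "(CLINT x|lborel. ?h1 x + ?h2 x) = 0"
  proof (rule integral_derivative_eq_0)
    fix x
    have e: "((\<lambda>x. iexp (x * t)) has_vector_derivative (\<i> * t) * iexp (x * t)) (at x)"
    proof -
      have "((\<lambda>z. exp (\<i> * (z * of_real t))) has_field_derivative (\<i> * t) * exp (\<i> * (of_real x * of_real t)))
          (at (of_real x))"
        by (auto intro!: derivative_eq_intros simp: algebra_simps)
      from has_vector_derivative_real_field[OF this] show ?thesis by simp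
    qed
    have d: "((\<lambda>x. complex_of_real (D x)) has_vector_derivative of_real (D' x)) (at x)"
      by (rule has_vector_derivative_of_real[OF deriv])
    show "(?h has_vector_derivative (?h1 x + ?h2 x)) (at x)"
      using has_vector_derivative_mult[OF d e] by (simp add: algebra_simps)
  next
    show "continuous_on UNIV (\<lambda>x. ?h1 x + ?h2 x)"
      by (intro continuous_intros cont continuous_D)
  qed (use int in auto)
  then have "(CLINT x|lborel. ?h1 x) + (CLINT x|lborel. ?h2 x) = 0"
    using Bochner_Integration.integral_add[OF int(2,3)] by metis
  then show ?thesis unfolding FT_def integral_mult_right_zero by (simp add: eq_neg_iff_add_eq_0)
qed

lemma bounded_of_integrable_derivative:
  fixes D D' :: "real \<Rightarrow> real"
  assumes deriv: "\<And>x. (D has_real_derivative D' x) (at x)" and cont: "continuous_on UNIV D'"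
    and D': "integrable lborel D'"
  shows "\<bar>D x\<bar> \<le> \<bar>D 0\<bar> + (\<integral>x. \<bar>D' x\<bar> \<partial>lborel)"
proof -
  have le: "\<bar>D b - D a\<bar> \<le> (\<integral>x. \<bar>D' x\<bar> \<partial>lborel)" if "a \<le> b" for a b
  proof -
    have [measurable]: "D' \<in> borel_measurable borel" using D' by auto
    have "(\<integral>x. indicator {a..b} x *\<^sub>R D' x \<partial>lborel) = D b - D a"
      using that deriv
      by (intro integral_FTC_Icc continuous_on_subset[OF cont])
         (auto simp: has_real_derivative_iff_has_vector_derivative[symmetric] intro: DERIV_subset)
    then have "\<bar>D b - D a\<bar> \<le> (\<integral>x. norm (indicator {a..b} x *\<^sub>R D' x) \<partial>lborel)"
      using integral_norm_bound[of lborel "\<lambda>x. indicator {a..b} x *\<^sub>R D' x"] by simp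
    also have "\<dots> \<le> (\<integral>x. \<bar>D' x\<bar> \<partial>lborel)"
      by (rule integral_mono_AE')
        (use D' in \<open>auto split: split_indicator\<close>)
    finally show ?thesis .
  qed
  show ?thesis using le[of 0 x] le[of x 0] by (cases "0 \<le> x") auto
qed

lemma integrable_inverse_1_plus_square_lborel: "integrable lborel (\<lambda>x::real. inverse (1 + x\<^sup>2))"
  using integrable_inverse_1_plus_square by (simp add: set_integrable_def)

text \<open>
  \<open>D k\<close> is the \<open>k\<close>-th derivative of the normalised transform of \<open>\<Phi>\<close>.
\<close>
locale smooth_transform =
  fixes \<Phi> :: "real \<Rightarrow> real" and D :: "nat \<Rightarrow> real \<Rightarrow> real" and C :: real
  assumes cont: "continuous_on UNIV \<Phi>" and int: "integrable lborel \<Phi>" and bdd: "\<And>x. \<bar>\<Phi> x\<bar> \<le> C"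
    and FT0: "\<And>w. FT (\<lambda>x. of_real (\<Phi> x)) w = of_real (sqrt (2 * pi) * D 0 w)"
    and deriv: "\<And>k x. (D k has_real_derivative D (Suc k) x) (at x)"
    and intD: "\<And>k. integrable lborel (D k)"
begin

lemma measurable_original [measurable]: "\<Phi> \<in> borel_measurable borel"
  using borel_measurable_integrable[OF int] by simp

lemma continuous_D: "continuous_on UNIV (D k)"
  using deriv by (meson DERIV_isCont continuous_at_imp_continuous_on)

text \<open>
  The case \<open>k = 0\<close> is the inversion formula for \<open>\<Phi>\<close>; each further derivative gives one factor \<open>x\<close>.
\<close>
lemma FT_D: "FT (\<lambda>x. of_real (D k x)) (- x) = \<i> ^ k * of_real (sqrt (2 * pi) * (x ^ k * \<Phi> x))"
proof (induction k)
  case 0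
  have "(CLINT w|lborel. FT (\<lambda>x. of_real (\<Phi> x)) w * iexp (- (x * w))) = of_real (2 * pi) * of_real (\<Phi> x)"
  proof (rule fourier_inversion)
    show "integrable lborel (FT (\<lambda>x. complex_of_real (\<Phi> x)))"
      unfolding FT0 using intD[of 0] by simp
    show "continuous_on UNIV (\<lambda>x. complex_of_real (\<Phi> x))" by (intro continuous_intros cont)
    show "norm (complex_of_real (\<Phi> x)) \<le> C" for x using bdd by simp
  qed (use int in simp)
  moreover have "(CLINT w|lborel. FT (\<lambda>x. of_real (\<Phi> x)) w * iexp (- (x * w)))
     = of_real (sqrt (2 * pi)) * FT (\<lambda>x. of_real (D 0 x)) (- x)"
    unfolding FT0 FT_def integral_mult_right_zero[symmetric]
    by (simp add: mult_ac)
  moreover have "of_real (2 * pi) = (of_real (sqrt (2 * pi)) * of_real (sqrt (2 * pi)) :: complex)"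
    by (simp flip: of_real_mult)
  ultimately have "of_real (sqrt (2 * pi)) * FT (\<lambda>x. of_real (D 0 x)) (- x)
     = of_real (sqrt (2 * pi)) * (of_real (sqrt (2 * pi)) * of_real (\<Phi> x))"
    by (simp only: mult.assoc)
  then show ?case by simp
next
  case (Suc k)
  have "FT (\<lambda>x. of_real (D (Suc k) x)) (- x) = (\<i> * x) * FT (\<lambda>x. of_real (D k x)) (- x)"
    by (subst FT_derivative[OF deriv continuous_D intD intD]) simp
  then show ?case unfolding Suc by (simp add: mult_ac)
qed

lemma moment_bound: "\<bar>x ^ k * \<Phi> x\<bar> \<le> (\<integral>x. \<bar>D k x\<bar> \<partial>lborel)"
proof -
  have "norm (\<i> ^ k * of_real (sqrt (2 * pi) * (x ^ k * \<Phi> x))) \<le> (\<integral>x. \<bar>D k x\<bar> \<partial>lborel)"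
    using norm_FT_le[of "\<lambda>x. of_real (D k x)" "- x"] unfolding FT_D by simp
  then have "sqrt (2 * pi) * \<bar>x ^ k * \<Phi> x\<bar> \<le> (\<integral>x. \<bar>D k x\<bar> \<partial>lborel)"
    by (simp add: norm_mult norm_power abs_mult power_abs)
  moreover have "1 * \<bar>x ^ k * \<Phi> x\<bar> \<le> sqrt (2 * pi) * \<bar>x ^ k * \<Phi> x\<bar>"
    using pi_gt3 by (intro mult_right_mono) auto
  ultimately show ?thesis by linarith
qed

text \<open>
  Both the moment of order \<open>k\<close> and that of order \<open>k + 2\<close> are bounded, so the former is dominated by a
  multiple of \<open>1 / (1 + x\<^sup>2)\<close>.
\<close>
lemma integrable_moment: "integrable lborel (\<lambda>x. x ^ k * \<Phi> x)"
proof (rule Bochner_Integration.integrable_bound)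
  let ?C = "(\<integral>x. \<bar>D k x\<bar> \<partial>lborel) + (\<integral>x. \<bar>D (k + 2) x\<bar> \<partial>lborel)"
  show "integrable lborel (\<lambda>x::real. ?C * inverse (1 + x\<^sup>2))"
    by (intro integrable_mult_right integrable_inverse_1_plus_square_lborel)
  show "AE x in lborel. norm (x ^ k * \<Phi> x) \<le> norm (?C * inverse (1 + x\<^sup>2))"
  proof (rule AE_I2)
    fix x :: real
    have "\<bar>x ^ k * \<Phi> x\<bar> + \<bar>x ^ (k + 2) * \<Phi> x\<bar> \<le> ?C" by (intro add_mono moment_bound)
    moreover have "\<bar>x ^ (k + 2) * \<Phi> x\<bar> = x\<^sup>2 * \<bar>x ^ k * \<Phi> x\<bar>"
      unfolding power_add by (simp add: abs_mult mult_ac)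
    ultimately have "\<bar>x ^ k * \<Phi> x\<bar> * (1 + x\<^sup>2) \<le> ?C" by (simp add: algebra_simps)
    moreover have "0 < 1 + x\<^sup>2" by (simp add: add_pos_nonneg)
    ultimately have "\<bar>x ^ k * \<Phi> x\<bar> \<le> ?C * inverse (1 + x\<^sup>2)" by (simp add: field_simps)
    then show "norm (x ^ k * \<Phi> x) \<le> norm (?C * inverse (1 + x\<^sup>2))" by (simp only: real_norm_def)
  qed
qed measurable

text \<open>
  Now \<open>D k\<close> is itself a bounded continuous function with an integrable transform, and inverting that
  transform, which is the moment by \<open>FT_D\<close>, recovers \<open>D k\<close>.
\<close>
lemma FT_moment: "FT (\<lambda>x. of_real (x ^ k * \<Phi> x)) w = (- \<i>) ^ k * of_real (sqrt (2 * pi) * D k w)"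
proof -
  let ?s = "complex_of_real (sqrt (2 * pi))"
  let ?m = "\<lambda>x. complex_of_real (x ^ k * \<Phi> x)"
  have F: "FT (\<lambda>x. of_real (D k x)) = (\<lambda>t. (\<i> ^ k * ?s) * ?m (- t))"
  proof
    fix t show "FT (\<lambda>x. of_real (D k x)) t = (\<i> ^ k * ?s) * ?m (- t)"
      using FT_D[of k "- t"] by (simp add: mult_ac)
  qed
  have "(CLINT t|lborel. FT (\<lambda>x. of_real (D k x)) t * iexp (- (w * t))) = of_real (2 * pi) * of_real (D k w)"
  proof (rule fourier_inversion)
    have "integrable lborel (\<lambda>t. ?m (0 + (- 1) * t))"
      by (rule lborel_integrable_real_affine[OF integrable_of_real[OF integrable_moment]]) simp
    then show "integrable lborel (FT (\<lambda>x. complex_of_real (D k x)))"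
      unfolding F by (intro integrable_mult_right) simp
    show "continuous_on UNIV (\<lambda>x. complex_of_real (D k x))" by (intro continuous_intros continuous_D)
    show "norm (complex_of_real (D k x)) \<le> \<bar>D k 0\<bar> + (\<integral>x. \<bar>D (Suc k) x\<bar> \<partial>lborel)" for x
      using bounded_of_integrable_derivative[OF deriv continuous_D intD] by simp
  qed (use intD in simp)
  also have "(CLINT t|lborel. FT (\<lambda>x. of_real (D k x)) t * iexp (- (w * t))) = (\<i> ^ k * ?s) * FT (\<lambda>t. ?m (- t)) (- w)"
    unfolding F FT_def integral_mult_right_zero[symmetric]
    by (simp only: mult.assoc mult_minus_right mult_minus_left mult.commute[of w])
  also have "FT (\<lambda>t. ?m (- t)) (- w) = FT ?m w"
    using FT_reflect[of ?m "- w"] by simp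
  finally have "(\<i> ^ k * ?s) * FT ?m w = of_real (2 * pi) * of_real (D k w)" .
  also have "complex_of_real (2 * pi) = ?s * ?s" by (simp flip: of_real_mult)
  finally have "\<i> ^ k * FT ?m w = ?s * of_real (D k w)" by simp
  then have "(- \<i>) ^ k * (\<i> ^ k * FT ?m w) = (- \<i>) ^ k * (?s * of_real (D k w))" by (simp only:)
  moreover have "(- \<i>) ^ k * \<i> ^ k = 1" by (simp flip: power_mult_distrib)
  ultimately show ?thesis by (simp flip: mult.assoc)
qed

end


section \<open>The transform of an integrable and square-integrable function\<close>

lemma norm_fourier_sq: "(norm (fourier f w))\<^sup>2 = (norm (FT (\<lambda>x. of_real (f x)) w))\<^sup>2 / (2 * pi)"
proof -
  have "norm (fourier f w) = norm (FT (\<lambda>x. of_real (f x)) w) / sqrt (2 * pi)"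
    unfolding fourier_eq_FT norm_mult norm_of_real by simp
  then show ?thesis by (simp add: power_divide)
qed

lemma fourier_measurable:
  assumes [measurable]: "f \<in> borel_measurable borel"
  shows "fourier f \<in> borel_measurable borel"
proof -
  have "FT (\<lambda>x. of_real (f x)) \<in> borel_measurable lborel" by measurable
  then show ?thesis unfolding fourier_eq_FT[abs_def] by simp
qed

lemma fourier_bessel:
  assumes "integrable lborel f"
  shows "(\<integral>\<^sup>+w. ennreal ((norm (fourier f w))\<^sup>2) \<partial>lborel) \<le> (\<integral>\<^sup>+x. ennreal ((f x)\<^sup>2) \<partial>lborel)"
proof -
  let ?F = "FT (\<lambda>x. of_real (f x))"
  have [measurable]: "f \<in> borel_measurable borel" using borel_measurable_integrable[OF assms] by simp
  have [measurable]: "?F \<in> borel_measurable borel" using FT_measurable[of "\<lambda>x. of_real (f x)"] by simp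
  have "(\<integral>\<^sup>+w. ennreal ((norm (fourier f w))\<^sup>2) \<partial>lborel)
      = (\<integral>\<^sup>+w. ennreal (1 / (2 * pi)) * ennreal ((norm (?F w))\<^sup>2) \<partial>lborel)"
    unfolding norm_fourier_sq by (intro nn_integral_cong) (simp flip: ennreal_mult)
  also have "\<dots> = ennreal (1 / (2 * pi)) * (\<integral>\<^sup>+w. ennreal ((norm (?F w))\<^sup>2) \<partial>lborel)"
    by (rule nn_integral_cmult) measurable
  also have "\<dots> \<le> ennreal (1 / (2 * pi)) * (ennreal (2 * pi) * (\<integral>\<^sup>+x. ennreal ((norm (of_real (f x) :: complex))\<^sup>2) \<partial>lborel))"
    using assms by (intro mult_left_mono FT_L2_le) auto
  also have "\<dots> = (ennreal (1 / (2 * pi)) * ennreal (2 * pi)) * (\<integral>\<^sup>+x. ennreal ((f x)\<^sup>2) \<partial>lborel)"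
    by (simp add: mult.assoc)
  also have "ennreal (1 / (2 * pi)) * ennreal (2 * pi) = ennreal (1 / (2 * pi) * (2 * pi))"
    by (rule ennreal_mult[symmetric]) auto
  finally show ?thesis by simp
qed

text \<open>
  The difference between \<open>f\<close> and its truncation is again integrable, so by \<open>fourier_bessel\<close> the \<open>L\<^sup>2\<close> distance
  of their transforms is at most that of the functions, which tends to \<open>0\<close>.
\<close>
lemma has_fourier_L2_fourier:
  assumes f: "integrable lborel f" and f2: "integrable lborel (\<lambda>x. (f x)\<^sup>2)"
  shows "has_fourier_L2 f (fourier f)"
  unfolding has_fourier_L2_def
proof (intro conjI)
  have [measurable]: "f \<in> borel_measurable borel" using borel_measurable_integrable[OF f] by simp
  show "fourier f \<in> borel_measurable lborel" using fourier_measurable[of f] by simp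
  have "(\<integral>\<^sup>+x. ennreal ((f x)\<^sup>2) \<partial>lborel) < \<infinity>"
    using f2 by (simp add: nn_integral_eq_integral)
  with fourier_bessel[OF f] show "(\<integral>\<^sup>+w. ennreal ((norm (fourier f w))\<^sup>2) \<partial>lborel) < \<infinity>"
    by (rule order.strict_trans1)
  let ?g = "\<lambda>R x. indicator {-R..R} x * f x - f x"
  have int: "integrable lborel (\<lambda>x. indicator {-R..R} x * f x)" for R
    using integrable_real_mult_indicator[of "{-R..R}" lborel f] f by (simp add: mult.commute)
  have "((\<lambda>R. integral\<^sup>L lborel (\<lambda>x. (?g R x)\<^sup>2)) \<longlongrightarrow> integral\<^sup>L lborel (\<lambda>x::real. 0::real)) at_top"
  proof (rule integral_dominated_convergence_at_top[where w = "\<lambda>x. (f x)\<^sup>2" and s = "\<lambda>R x. (?g R x)\<^sup>2" and M = lborel and f = "\<lambda>x::real. 0::real"])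
    show "AE x in lborel. ((\<lambda>R. (?g R x)\<^sup>2) \<longlongrightarrow> 0) at_top"
    proof (rule AE_I2, rule tendsto_eventually)
      fix x
      show "eventually (\<lambda>R. (?g R x)\<^sup>2 = 0) at_top"
        using eventually_ge_at_top[of "\<bar>x\<bar>"] by eventually_elim (auto simp: indicator_def)
    qed
  qed (use f2 in \<open>auto intro!: always_eventually split: split_indicator\<close>)
  then have lim: "((\<lambda>R. ennreal (\<integral>x. (?g R x)\<^sup>2 \<partial>lborel)) \<longlongrightarrow> 0) at_top"
    using tendsto_ennrealI[of _ 0] by simp
  show "((\<lambda>R. \<integral>\<^sup>+w. ennreal ((norm (fourier (\<lambda>x. indicator {-R..R} x * f x) w - fourier f w))\<^sup>2) \<partial>lborel) \<longlongrightarrow> 0) at_top"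
  proof (rule tendsto_sandwich[OF _ _ tendsto_const lim])
    show "eventually (\<lambda>R. (\<integral>\<^sup>+w. ennreal ((norm (fourier (\<lambda>x. indicator {-R..R} x * f x) w - fourier f w))\<^sup>2) \<partial>lborel)
       \<le> ennreal (\<integral>x. (?g R x)\<^sup>2 \<partial>lborel)) at_top"
    proof (intro always_eventually allI)
      fix R
      have "fourier (\<lambda>x. indicator {-R..R} x * f x) w - fourier f w = fourier (?g R) w" for w
      proof -
        have "FT (\<lambda>x. of_real (indicator {-R..R} x * f x) - of_real (f x)) w
          = FT (\<lambda>x. of_real (indicator {-R..R} x * f x)) w - FT (\<lambda>x. of_real (f x)) w"
          by (intro FT_diff integrable_of_real int f)
        then show ?thesis unfolding fourier_eq_FT by (simp add: right_diff_distrib)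
      qed
      then have "(\<integral>\<^sup>+w. ennreal ((norm (fourier (\<lambda>x. indicator {-R..R} x * f x) w - fourier f w))\<^sup>2) \<partial>lborel)
        = (\<integral>\<^sup>+w. ennreal ((norm (fourier (?g R) w))\<^sup>2) \<partial>lborel)" by simp
      also have "\<dots> \<le> (\<integral>\<^sup>+x. ennreal ((?g R x)\<^sup>2) \<partial>lborel)"
        by (intro fourier_bessel Bochner_Integration.integrable_diff int f)
      also have "\<dots> = ennreal (\<integral>x. (?g R x)\<^sup>2 \<partial>lborel)"
      proof (rule nn_integral_eq_integral)
        show "integrable lborel (\<lambda>x. (?g R x)\<^sup>2)"
          by (rule Bochner_Integration.integrable_bound[OF f2]) (auto split: split_indicator)
      qed simp
      finally show "(\<integral>\<^sup>+w. ennreal ((norm (fourier (\<lambda>x. indicator {-R..R} x * f x) w - fourier f w))\<^sup>2) \<partial>lborel)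
         \<le> ennreal (\<integral>x. (?g R x)\<^sup>2 \<partial>lborel)" .
    qed
  qed simp
qed

lemma has_fourier_L2_unique:
  assumes f: "f \<in> borel_measurable borel" and g: "has_fourier_L2 f g" and g': "has_fourier_L2 f g'"
  shows "AE w in lborel. g w = g' w"
proof -
  let ?F = "\<lambda>R. fourier (\<lambda>x. indicator {-R..R::real} x * f x)"
  have [measurable]: "g \<in> borel_measurable borel" "g' \<in> borel_measurable borel"
    using g g' by (auto simp: has_fourier_L2_def)
  have [measurable]: "?F R \<in> borel_measurable borel" for R
    using f by (intro fourier_measurable) measurable
  have "((\<lambda>R. 2 * (\<integral>\<^sup>+w. ennreal ((norm (?F R w - g w))\<^sup>2) \<partial>lborel)
      + 2 * (\<integral>\<^sup>+w. ennreal ((norm (?F R w - g' w))\<^sup>2) \<partial>lborel)) \<longlongrightarrow> 2 * 0 + 2 * 0) at_top"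
    using g g' by (intro tendsto_add ennreal_tendsto_cmult) (auto simp: has_fourier_L2_def)
  moreover have "(\<integral>\<^sup>+w. ennreal ((norm (g w - g' w))\<^sup>2) \<partial>lborel) \<le>
      2 * (\<integral>\<^sup>+w. ennreal ((norm (?F R w - g w))\<^sup>2) \<partial>lborel)
      + 2 * (\<integral>\<^sup>+w. ennreal ((norm (?F R w - g' w))\<^sup>2) \<partial>lborel)" for R
  proof -
    have "(\<integral>\<^sup>+w. ennreal ((norm (g w - g' w))\<^sup>2) \<partial>lborel) \<le>
       (\<integral>\<^sup>+w. 2 * ennreal ((norm (?F R w - g w))\<^sup>2) + 2 * ennreal ((norm (?F R w - g' w))\<^sup>2) \<partial>lborel)"
    proof (intro nn_integral_mono)
      fix w
      let ?a = "norm (?F R w - g w)" and ?b = "norm (?F R w - g' w)"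
      have "norm (g w - g' w) \<le> ?a + ?b"
        using norm_triangle_ineq4[of "?F R w - g' w" "?F R w - g w"] by simp
      then have "(norm (g w - g' w))\<^sup>2 \<le> (?a + ?b)\<^sup>2" by (intro power_mono) auto
      also have "\<dots> \<le> 2 * ?a\<^sup>2 + 2 * ?b\<^sup>2"
        using sum_squares_bound[of ?a ?b] by (simp add: power2_sum)
      finally have "ennreal ((norm (g w - g' w))\<^sup>2) \<le> ennreal (2 * ?a\<^sup>2 + 2 * ?b\<^sup>2)"
        by (rule ennreal_leI)
      then show "ennreal ((norm (g w - g' w))\<^sup>2) \<le> 2 * ennreal (?a\<^sup>2) + 2 * ennreal (?b\<^sup>2)"
        by (simp add: ennreal_mult')
    qed
    also have "\<dots> = 2 * (\<integral>\<^sup>+w. ennreal ((norm (?F R w - g w))\<^sup>2) \<partial>lborel)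
      + 2 * (\<integral>\<^sup>+w. ennreal ((norm (?F R w - g' w))\<^sup>2) \<partial>lborel)"
      by (simp add: nn_integral_add nn_integral_cmult)
    finally show ?thesis .
  qed
  ultimately have "(\<integral>\<^sup>+w. ennreal ((norm (g w - g' w))\<^sup>2) \<partial>lborel) \<le> 2 * 0 + 2 * 0"
    by (intro tendsto_lowerbound[of _ _ at_top]) auto
  then have "(\<integral>\<^sup>+w. ennreal ((norm (g w - g' w))\<^sup>2) \<partial>lborel) = 0" by simp
  then have "AE w in lborel. ennreal ((norm (g w - g' w))\<^sup>2) = 0"
    by (subst (asm) nn_integral_0_iff_AE) auto
  then show ?thesis by eventually_elim simp
qed

lemma fourier_L2_eq_fourier:
  assumes "integrable lborel f" "integrable lborel (\<lambda>x. (f x)\<^sup>2)"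
  shows "AE w in lborel. fourier_L2 f w = fourier f w"
proof (rule has_fourier_L2_unique)
  show "f \<in> borel_measurable borel" using borel_measurable_integrable[OF assms(1)] by simp
  show "has_fourier_L2 f (fourier f)" by (rule has_fourier_L2_fourier[OF assms])
  then show "has_fourier_L2 f (fourier_L2 f)"
    unfolding fourier_L2_def by (rule someI[of "has_fourier_L2 f"])
qed


section \<open>Polynomial multiples of the kernel function in H(K)\<close>

lemma psd_function_even: "psd_function \<Phi> \<Longrightarrow> \<Phi> (- x) = \<Phi> x"
  unfolding psd_function_def psd_kernel_def by (metis diff_0 diff_0_right)

lemma psd_function_bounded:
  assumes "psd_function \<Phi>"
  shows "\<bar>\<Phi> x\<bar> \<le> \<Phi> 0"
proof -
  have *: "0 \<le> (\<Sum>i<(2::nat). \<Sum>j<2. c i * c j * \<Phi> (y i - y j))" for c y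
    using assms unfolding psd_function_def psd_kernel_def by blast
  have e: "{..<2} = {0, 1::nat}" by auto
  have "0 \<le> \<Phi> 0 + s * \<Phi> x" if "s * s = 1" for s
  proof -
    have "0 \<le> \<Phi> 0 + (s * (s * \<Phi> 0) + s * (\<Phi> x * 2))"
      using *[of "\<lambda>i. if i = 0 then 1 else s" "\<lambda>i. if i = 0 then x else 0"]
        psd_function_even[OF assms, of x]
      by (simp add: e algebra_simps)
    moreover have "s * (s * \<Phi> 0) = \<Phi> 0" using that by (simp flip: mult.assoc)
    ultimately show ?thesis by simp
  qed
  from this[of 1] this[of "-1"] show ?thesis by simp
qed

lemma fourier_psd_real:
  assumes "psd_function \<Phi>"
  shows "fourier \<Phi> w = of_real (fourier_real \<Phi> w)"
proof -
  let ?F = "FT (\<lambda>x. of_real (\<Phi> x))"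
  have "cnj (?F w) = FT (\<lambda>x. of_real (\<Phi> x)) (- w)"
    unfolding FT_def Bochner_Integration.integral_cnj[symmetric] by (simp add: exp_cnj)
  also have "\<dots> = ?F w"
    using FT_reflect[of "\<lambda>x. of_real (\<Phi> x)" w] by (simp add: psd_function_even[OF assms])
  finally have "cnj (fourier \<Phi> w) = fourier \<Phi> w"
    unfolding fourier_eq_FT by simp
  then show ?thesis unfolding fourier_real_def by (simp add: complex_eq_iff)
qed

text \<open>
  This inequality is what turns finiteness of the weighted integrals \<open>beta\<close> into integrability of
  the derivatives.  It also holds for \<open>p \<le> 0\<close>: then \<open>ennreal p = 0\<close> and the quotient is infinite unless
  \<open>d = 0\<close>.
\<close>
lemma abs_le_quotient: "ennreal \<bar>d\<bar> \<le> ennreal (d\<^sup>2) / ennreal p + ennreal p"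
proof (cases "0 < p")
  case True
  have "\<bar>d\<bar> * p \<le> d\<^sup>2 + p * p"
  proof -
    have "0 \<le> \<bar>d\<bar> * p" using True by simp
    then show ?thesis
      using sum_squares_bound[of "\<bar>d\<bar>" p] unfolding power2_eq_square[of p] power2_abs by linarith
  qed
  then have "\<bar>d\<bar> \<le> d\<^sup>2 / p + p" using True by (simp add: field_simps)
  then show ?thesis using True by (simp add: divide_ennreal ennreal_leI flip: ennreal_plus)
next
  case False
  then show ?thesis by (cases "d = 0") (auto simp: ennreal_neg divide_ennreal_def ennreal_mult_top)
qed

lemma le_quotient_self: "ennreal p \<le> ennreal (p\<^sup>2) / ennreal p"
  by (cases "0 < p") (auto simp: divide_ennreal power2_eq_square ennreal_neg)

locale smooth_kernel =
  fixes \<Phi> :: "real \<Rightarrow> real"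
  assumes cont: "continuous_on UNIV \<Phi>" and int: "integrable lborel \<Phi>" and psd: "psd_function \<Phi>"
    and smooth: "infinitely_differentiable (fourier_real \<Phi>)"
    and beta_finite: "\<And>n. beta \<Phi> n < \<infinity>"
begin

abbreviation D :: "nat \<Rightarrow> real \<Rightarrow> real" where
  "D k \<equiv> (deriv ^^ k) (fourier_real \<Phi>)"

lemma D_deriv: "(D k has_real_derivative D (Suc k) x) (at x)"
proof -
  have "D k differentiable (at x)"
    using smooth unfolding infinitely_differentiable_def differentiable_on_def by simp
  then show ?thesis by (simp add: DERIV_deriv_iff_real_differentiable)
qed

lemma D_continuous: "continuous_on UNIV (D k)"
  using D_deriv by (meson DERIV_isCont continuous_at_imp_continuous_on)

lemma D_measurable [measurable]: "D k \<in> borel_measurable borel"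
  by (rule borel_measurable_continuous_onI[OF D_continuous])

lemma D_weighted_finite: "(\<integral>\<^sup>+w. ennreal ((D k w)\<^sup>2) / ennreal (fourier_real \<Phi> w) \<partial>lborel) < \<infinity>"
  using beta_finite[of k] unfolding beta_def by (auto simp: ennreal_mult_less_top)

lemma D_integrable: "integrable lborel (D k)"
proof (rule integrableI_bounded)
  have "(\<integral>\<^sup>+w. ennreal (norm (D k w)) \<partial>lborel)
     \<le> (\<integral>\<^sup>+w. ennreal ((D k w)\<^sup>2) / ennreal (fourier_real \<Phi> w) + ennreal ((D 0 w)\<^sup>2) / ennreal (fourier_real \<Phi> w) \<partial>lborel)"
  proof (intro nn_integral_mono)
    fix w
    have "ennreal \<bar>D k w\<bar> \<le> ennreal ((D k w)\<^sup>2) / ennreal (fourier_real \<Phi> w) + ennreal (fourier_real \<Phi> w)"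
      by (rule abs_le_quotient)
    \<comment> \<open>The transform itself is bounded by the integrand of \<open>beta \<Phi> 0\<close>.\<close>
    also have "\<dots> \<le> ennreal ((D k w)\<^sup>2) / ennreal (fourier_real \<Phi> w) + ennreal ((D 0 w)\<^sup>2) / ennreal (fourier_real \<Phi> w)"
      using le_quotient_self[of "fourier_real \<Phi> w"] by (intro add_left_mono) simp
    finally show "ennreal (norm (D k w)) \<le> ennreal ((D k w)\<^sup>2) / ennreal (fourier_real \<Phi> w) + ennreal ((D 0 w)\<^sup>2) / ennreal (fourier_real \<Phi> w)"
      by simp
  qed
  also have "\<dots> = (\<integral>\<^sup>+w. ennreal ((D k w)\<^sup>2) / ennreal (fourier_real \<Phi> w) \<partial>lborel)
     + (\<integral>\<^sup>+w. ennreal ((D 0 w)\<^sup>2) / ennreal (fourier_real \<Phi> w) \<partial>lborel)"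
    using D_measurable[of 0] D_measurable[of k] by (intro nn_integral_add) auto
  also have "\<dots> < \<infinity>" using D_weighted_finite[of k] D_weighted_finite[of 0] by simp
  finally show "(\<integral>\<^sup>+w. ennreal (norm (D k w)) \<partial>lborel) < \<infinity>" .
qed simp

sublocale smooth_transform \<Phi> D "\<Phi> 0"
proof
  show "FT (\<lambda>x. of_real (\<Phi> x)) w = of_real (sqrt (2 * pi) * D 0 w)" for w
    using fourier_psd_real[OF psd, of w] unfolding fourier_eq_FT by (simp add: field_simps)
qed (fact cont int psd_function_bounded[OF psd] D_deriv D_integrable)+

definition poly_kernel :: "real poly \<Rightarrow> real \<Rightarrow> real" where
  "poly_kernel q x = poly q x * \<Phi> x"

lemma poly_kernel_eq: "degree q \<le> n \<Longrightarrow> poly_kernel q x = (\<Sum>k\<le>n. coeff q k * (x ^ k * \<Phi> x))"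
  by (subst poly_as_sum_of_monoms'[symmetric, of q n])
     (simp_all add: poly_kernel_def poly_sum poly_monom sum_distrib_right mult.assoc coeff_sum if_distrib cong: if_cong)

lemma poly_kernel_continuous: "continuous_on UNIV (poly_kernel q)"
  unfolding poly_kernel_def[abs_def] by (intro continuous_intros cont)

lemma poly_kernel_integrable: "integrable lborel (poly_kernel q)"
  unfolding poly_kernel_eq[OF order.refl, abs_def]
  by (intro Bochner_Integration.integrable_sum integrable_mult_right integrable_moment)

lemma poly_kernel_square_integrable: "integrable lborel (\<lambda>x. (poly_kernel q x)\<^sup>2)"
proof (rule Bochner_Integration.integrable_bound)
  let ?C = "\<Sum>k\<le>degree q. \<bar>coeff q k\<bar> * (\<integral>x. \<bar>D k x\<bar> \<partial>lborel)"
  have bd: "\<bar>poly_kernel q x\<bar> \<le> ?C" for x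
    unfolding poly_kernel_eq[OF order.refl]
    by (rule order.trans[OF sum_abs]) (auto simp: abs_mult[of "coeff q _"] intro!: sum_mono mult_left_mono moment_bound)
  show "integrable lborel (\<lambda>x. ?C * poly_kernel q x)" using poly_kernel_integrable by simp
  show "AE x in lborel. norm ((poly_kernel q x)\<^sup>2) \<le> norm (?C * poly_kernel q x)"
  proof (rule AE_I2)
    fix x
    have "\<bar>poly_kernel q x\<bar> * \<bar>poly_kernel q x\<bar> \<le> \<bar>?C\<bar> * \<bar>poly_kernel q x\<bar>"
      using bd[of x] by (intro mult_right_mono) auto
    then show "norm ((poly_kernel q x)\<^sup>2) \<le> norm (?C * poly_kernel q x)"
      by (simp only: real_norm_def power2_eq_square abs_mult)
  qed
  show "(\<lambda>x. (poly_kernel q x)\<^sup>2) \<in> borel_measurable lborel"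
    using borel_measurable_integrable[OF poly_kernel_integrable, of q] by measurable
qed

lemma fourier_poly_kernel:
  assumes "degree q \<le> n"
  shows "fourier (poly_kernel q) w = (\<Sum>k\<le>n. of_real (coeff q k) * ((- \<i>) ^ k * of_real (D k w)))"
proof -
  have "FT (\<lambda>x. of_real (poly_kernel q x)) w = FT (\<lambda>x. \<Sum>k\<le>n. of_real (coeff q k) * of_real (x ^ k * \<Phi> x)) w"
    unfolding poly_kernel_eq[OF assms] by simp
  also have "\<dots> = (\<Sum>k\<le>n. FT (\<lambda>x. of_real (coeff q k) * of_real (x ^ k * \<Phi> x)) w)"
    by (intro FT_sum integrable_mult_right integrable_of_real integrable_moment) auto
  also have "\<dots> = (\<Sum>k\<le>n. of_real (coeff q k) * FT (\<lambda>x. of_real (x ^ k * \<Phi> x)) w)"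
    unfolding FT_cmult ..
  finally show ?thesis
    unfolding fourier_eq_FT FT_moment by (simp add: sum_distrib_left mult_ac)
qed

text \<open>
  Cauchy-Schwarz over the \<open>n + 1\<close> summands; this is the source of the factor \<open>(n + 1)\<^bsup>-1/2\<^esup>\<close> in the
  error bounds.
\<close>
lemma norm_fourier_poly_kernel_sq_le:
  assumes "degree q \<le> n"
  shows "(norm (fourier (poly_kernel q) w))\<^sup>2 \<le> (\<Sum>k\<le>n. (real (n + 1) * (coeff q k)\<^sup>2) * (D k w)\<^sup>2)"
proof -
  have "norm (fourier (poly_kernel q) w) \<le> (\<Sum>k\<le>n. \<bar>coeff q k * D k w\<bar>)"
    unfolding fourier_poly_kernel[OF assms]
    by (rule order.trans[OF norm_sum]) (auto simp: norm_mult norm_power abs_mult intro!: sum_mono)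
  then have "(norm (fourier (poly_kernel q) w))\<^sup>2 \<le> (\<Sum>k\<le>n. 1 * \<bar>coeff q k * D k w\<bar>)\<^sup>2"
    by (intro power_mono) auto
  also have "\<dots> \<le> (\<Sum>k\<le>n. 1\<^sup>2) * (\<Sum>k\<le>n. \<bar>coeff q k * D k w\<bar>\<^sup>2)"
    by (rule Cauchy_Schwarz_ineq_sum)
  also have "\<dots> = (\<Sum>k\<le>n. (real (n + 1) * (coeff q k)\<^sup>2) * (D k w)\<^sup>2)"
    by (simp add: sum_distrib_left power_mult_distrib mult_ac)
  finally show ?thesis .
qed

lemma H_norm_sq_poly_kernel_le:
  assumes "degree q \<le> n"
  shows "H_norm_sq \<Phi> (poly_kernel q) \<le> (\<Sum>k\<le>n. ennreal (real (n + 1) * (coeff q k)\<^sup>2) * beta \<Phi> k)"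
proof -
  let ?P = "\<lambda>w. ennreal (fourier_real \<Phi> w)"
  let ?c = "\<lambda>k. ennreal (real (n + 1) * (coeff q k)\<^sup>2)"
  have [measurable]: "fourier_real \<Phi> \<in> borel_measurable borel" using D_measurable[of 0] by simp
  have "(\<integral>\<^sup>+w. ennreal ((norm (fourier_L2 (poly_kernel q) w))\<^sup>2) / ?P w \<partial>lborel)
     = (\<integral>\<^sup>+w. ennreal ((norm (fourier (poly_kernel q) w))\<^sup>2) / ?P w \<partial>lborel)"
    using fourier_L2_eq_fourier[OF poly_kernel_integrable poly_kernel_square_integrable, of q]
    by (intro nn_integral_cong_AE) (auto elim!: eventually_mono)
  also have "\<dots> \<le> (\<integral>\<^sup>+w. (\<Sum>k\<le>n. ?c k * (ennreal ((D k w)\<^sup>2) / ?P w)) \<partial>lborel)"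
  proof (intro nn_integral_mono)
    fix w
    have "ennreal ((norm (fourier (poly_kernel q) w))\<^sup>2) \<le> (\<Sum>k\<le>n. ?c k * ennreal ((D k w)\<^sup>2))"
    proof -
      have "(\<Sum>k\<le>n. ?c k * ennreal ((D k w)\<^sup>2)) = (\<Sum>k\<le>n. ennreal ((real (n + 1) * (coeff q k)\<^sup>2) * (D k w)\<^sup>2))"
        by (intro sum.cong refl ennreal_mult[symmetric]) auto
      also have "\<dots> = ennreal (\<Sum>k\<le>n. (real (n + 1) * (coeff q k)\<^sup>2) * (D k w)\<^sup>2)"
        by (intro sum_ennreal) auto
      finally show ?thesis
        using norm_fourier_poly_kernel_sq_le[OF assms, of w] by (simp only: ennreal_leI)
    qed
    from divide_right_mono_ennreal[OF this, of "?P w"]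
    show "ennreal ((norm (fourier (poly_kernel q) w))\<^sup>2) / ?P w \<le> (\<Sum>k\<le>n. ?c k * (ennreal ((D k w)\<^sup>2) / ?P w))"
      by (simp add: divide_ennreal_def sum_distrib_right mult.assoc)
  qed
  also have "\<dots> = (\<Sum>k\<le>n. ?c k * (\<integral>\<^sup>+w. ennreal ((D k w)\<^sup>2) / ?P w \<partial>lborel))"
    by (subst nn_integral_sum) (auto simp: nn_integral_cmult)
  finally have "H_norm_sq \<Phi> (poly_kernel q) \<le> ennreal (1 / sqrt (2 * pi)) * (\<Sum>k\<le>n. ?c k * (\<integral>\<^sup>+w. ennreal ((D k w)\<^sup>2) / ?P w \<partial>lborel))"
    unfolding H_norm_sq_def by (rule mult_left_mono) simp
  also have "\<dots> = (\<Sum>k\<le>n. ?c k * beta \<Phi> k)"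
    unfolding beta_def sum_distrib_left by (simp only: mult_ac)
  finally show ?thesis .
qed

lemma poly_kernel_in_H_space: "poly_kernel q \<in> H_space \<Phi>"
proof -
  have "H_norm_sq \<Phi> (poly_kernel q) < \<infinity>"
    using H_norm_sq_poly_kernel_le[OF order.refl, of q] beta_finite
    by (auto simp: ennreal_mult_less_top intro!: le_less_trans[OF H_norm_sq_poly_kernel_le[OF order.refl, of q]])
  then show ?thesis
    unfolding H_space_def using poly_kernel_continuous poly_kernel_square_integrable by simp
qed

lemma H_norm_poly_kernel_sq_le:
  assumes q: "degree q \<le> n" and pos: "0 < enn2real (beta \<Phi> n)"
    and ratio: "\<And>k. k \<le> n \<Longrightarrow> beta \<Phi> k / beta \<Phi> n \<le> ennreal (lam ^ (n - k) * fact k / fact n)"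
    and lam: "0 \<le> lam"
  shows "(H_norm \<Phi> (poly_kernel q))\<^sup>2 \<le> real (n + 1) * enn2real (beta \<Phi> n) *
           (\<Sum>k\<le>n. (coeff q k)\<^sup>2 * (lam ^ (n - k) * fact k / fact n))"
proof -
  define b where "b k = enn2real (beta \<Phi> k)" for k
  let ?w = "\<lambda>k. lam ^ (n - k) * fact k / fact n :: real"
  have b: "beta \<Phi> k = ennreal (b k)" for k unfolding b_def using beta_finite[of k] by simp
  have pos: "0 < b n" using pos by (simp add: b_def)
  have le: "b k \<le> ?w k * b n" if "k \<le> n" for k
  proof -
    have "ennreal (b k / b n) \<le> ennreal (?w k)"
      using ratio[OF that] pos unfolding b[of k] b[of n] by (simp add: divide_ennreal b_def)
    then have "b k / b n \<le> ?w k"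
      using lam by (subst (asm) ennreal_le_iff) auto
    then show ?thesis using pos by (simp add: field_simps)
  qed
  let ?r = "\<Sum>k\<le>n. (real (n + 1) * (coeff q k)\<^sup>2) * (?w k * b n)"
  have "(\<Sum>k\<le>n. ennreal (real (n + 1) * (coeff q k)\<^sup>2) * beta \<Phi> k)
     \<le> (\<Sum>k\<le>n. ennreal ((real (n + 1) * (coeff q k)\<^sup>2) * (?w k * b n)))"
  proof (intro sum_mono)
    fix k assume "k \<in> {..n}"
    then have "(real (n + 1) * (coeff q k)\<^sup>2) * b k \<le> (real (n + 1) * (coeff q k)\<^sup>2) * (?w k * b n)"
      using le by (intro mult_left_mono) auto
    then show "ennreal (real (n + 1) * (coeff q k)\<^sup>2) * beta \<Phi> k
        \<le> ennreal ((real (n + 1) * (coeff q k)\<^sup>2) * (?w k * b n))"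
      unfolding b by (subst ennreal_mult[symmetric]) (auto simp: b_def intro!: ennreal_leI)
  qed
  also have "\<dots> = ennreal ?r"
    using lam pos by (intro sum_ennreal) auto
  finally have "H_norm_sq \<Phi> (poly_kernel q) \<le> ennreal ?r"
    using H_norm_sq_poly_kernel_le[OF q] by (rule order.trans[rotated])
  then have "enn2real (H_norm_sq \<Phi> (poly_kernel q)) \<le> ?r"
    using lam pos by (intro enn2real_leI) (auto intro!: sum_nonneg)
  also have "?r = real (n + 1) * b n * (\<Sum>k\<le>n. (coeff q k)\<^sup>2 * ?w k)"
    by (simp add: sum_distrib_left mult_ac)
  finally show ?thesis by (simp add: H_norm_def b_def)
qed

end


section \<open>Lower bounds for worst-case errors\<close>

text \<open>
  The set where \<open>\<bar>g\<bar>\<close> is at most the essential supremum is closed and contains almost every point of the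
  open interval, hence all of its closure.
\<close>
lemma esssup_ge_continuous:
  fixes g :: "real \<Rightarrow> real"
  assumes cont: "continuous_on UNIV g" and t: "t \<in> {-1..1}"
  shows "ennreal \<bar>g t\<bar> \<le> esssup (lebesgue_on {-1..1}) (\<lambda>x. ennreal \<bar>g x\<bar>)"
proof (cases "esssup (lebesgue_on {-1..1}) (\<lambda>x. ennreal \<bar>g x\<bar>)")
  case (real r)
  define C where "C = {x. \<bar>g x\<bar> \<le> r}"
  have "closed C" unfolding C_def
    using cont by (intro closed_Collect_le continuous_intros) auto
  have "AE x in lebesgue_on {-1..1}. ennreal \<bar>g x\<bar> \<le> ennreal r"
    using esssup_AE[of "\<lambda>x. ennreal \<bar>g x\<bar>" "lebesgue_on {-1..1}"] real by simp
  then have "AE x in lebesgue. x \<in> {-1..1} \<longrightarrow> ennreal \<bar>g x\<bar> \<le> ennreal r"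
    by (subst (asm) AE_restrict_space_iff) auto
  then have "AE x \<in> {-1<..<1} in lebesgue. x \<in> C"
    by eventually_elim (use real in \<open>auto simp: C_def\<close>)
  then have "{-1<..<1} \<subseteq> C"
    using mem_closed_if_AE_lebesgue_open[OF open_greaterThanLessThan \<open>closed C\<close>] by blast
  then have "closure {-1<..<1} \<subseteq> C" using \<open>closed C\<close> by (rule closure_minimal)
  then show ?thesis using t real by (auto simp: C_def closure_greaterThanLessThan ennreal_leI)
qed simp

lemma Lp_norm_inf_ge:
  fixes g :: "real \<Rightarrow> real"
  assumes "continuous_on UNIV g" "t \<in> {-1..1}"
  shows "ennreal \<bar>g t\<bar> \<le> Lp_norm \<infinity> g"
  using esssup_ge_continuous[OF assms] by (simp add: Lp_norm_def)

lemma Lp_norm_2_ge: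
  fixes g h :: "real \<Rightarrow> real"
  assumes h: "continuous_on {-1..1} h" and le: "\<And>x. x \<in> {-1..1} \<Longrightarrow> \<bar>h x\<bar> \<le> \<bar>g x\<bar>"
  shows "ennreal (sqrt (integral {-1..1} (\<lambda>x. (h x)\<^sup>2))) \<le> Lp_norm 2 g"
proof -
  define I where "I = (\<integral>\<^sup>+x. ennreal (\<bar>g x\<bar> powr enn2real 2) \<partial>lebesgue_on {-1..1})"
  let ?J = "integral {-1..1} (\<lambda>x. (h x)\<^sup>2)"
  have int: "integrable (lebesgue_on {-1..1}) (\<lambda>x. (h x)\<^sup>2)"
    by (intro continuous_imp_integrable_real continuous_intros h)
  have "ennreal ?J = ennreal (integral\<^sup>L (lebesgue_on {-1..1}) (\<lambda>x. (h x)\<^sup>2))"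
    using int by (subst lebesgue_integral_eq_integral) auto
  also have "\<dots> = (\<integral>\<^sup>+x. ennreal ((h x)\<^sup>2) \<partial>lebesgue_on {-1..1})"
    using int by (subst nn_integral_eq_integral) auto
  also have "\<dots> \<le> I"
    unfolding I_def
  proof (intro nn_integral_mono ennreal_leI)
    fix x assume "x \<in> space (lebesgue_on {-1..1::real})"
    then have "\<bar>h x\<bar> \<le> \<bar>g x\<bar>" using le by simp
    then have "(h x)\<^sup>2 \<le> (g x)\<^sup>2" by (simp add: abs_le_square_iff)
    then show "(h x)\<^sup>2 \<le> \<bar>g x\<bar> powr enn2real 2"
      using powr_realpow'[of "\<bar>g x\<bar>" 2] by simp
  qed
  finally have J: "ennreal ?J \<le> I" .
  have L: "Lp_norm 2 g = (if I = \<infinity> then \<infinity> else ennreal (enn2real I powr (1 / 2)))"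
    unfolding Lp_norm_def I_def Let_def by simp
  show ?thesis
  proof (cases "I = \<infinity>")
    case True
    then show ?thesis by (simp add: L)
  next
    case False
    then have "?J \<le> enn2real I"
      using J by (cases I) (auto simp: ennreal_le_iff2)
    then have "sqrt ?J \<le> enn2real I powr (1 / 2)" by (simp add: powr_half_sqrt)
    then show ?thesis using False by (simp add: L ennreal_leI)
  qed
qed

text \<open>
  For \<open>H = 0\<close> the quotient is infinite, which is why \<open>N\<close> has to be positive.
\<close>
lemma ennreal_le_divide_of_mult_le:
  assumes "c * H \<le> N" "0 < N" "0 \<le> H"
  shows "ennreal c \<le> ennreal N / ennreal H"
proof (cases "H = 0")
  case True
  then show ?thesis using assms by (simp add: divide_ennreal_def ennreal_mult_top)
next
  case False
  then have "c \<le> N / H" using assms by (simp add: field_simps)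
  then show ?thesis using assms False by (simp add: divide_ennreal ennreal_leI)
qed

text \<open>
  For a function vanishing at the nodes every reconstruction is \<open>0\<close>, whatever the \<open>\<psi> k\<close> are.
\<close>
lemma e_min_pts_ge:
  assumes f: "f \<in> H_space \<Phi>" and vanish: "\<And>k. k \<in> {1..n} \<Longrightarrow> f (x k) = 0"
    and N: "ennreal N \<le> Lp_norm p f" "0 < N" and nz: "f \<noteq> (\<lambda>_. 0)" and c: "c * H_norm \<Phi> f \<le> N"
  shows "ennreal c \<le> e_min_pts \<Phi> p n x"
  unfolding e_min_pts_def
proof (rule INF_greatest)
  fix \<psi> :: "nat \<Rightarrow> real \<Rightarrow> real"
  have "ennreal c \<le> ennreal N / ennreal (H_norm \<Phi> f)"
    using c N(2) by (rule ennreal_le_divide_of_mult_le) (simp add: H_norm_def)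
  also have "\<dots> \<le> Lp_norm p f / ennreal (H_norm \<Phi> f)"
    by (rule divide_right_mono_ennreal[OF N(1)])
  also have "f = (\<lambda>t. f t - (\<Sum>k=1..n. f (x k) * \<psi> k t))"
    using vanish by (intro ext) simp
  finally show "ennreal c \<le> (SUP f \<in> H_space \<Phi> - {\<lambda>_. 0}.
      Lp_norm p (\<lambda>t. f t - (\<Sum>k=1..n. f (x k) * \<psi> k t)) / ennreal (H_norm \<Phi> f))"
    using f nz vanish by (intro SUP_upper2[of f]) simp_all
qed

lemma e_min_at_ge:
  assumes f: "f \<in> H_space \<Phi>" and vanish: "\<And>k. k \<in> {1..n} \<Longrightarrow> f (x k) = 0"
    and N: "N \<le> \<bar>f t\<bar>" "0 < N" and c: "c * H_norm \<Phi> f \<le> N"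
  shows "ennreal c \<le> e_min_at \<Phi> n x t"
  unfolding e_min_at_def
proof (rule INF_greatest)
  fix u :: "nat \<Rightarrow> real"
  have "ennreal c \<le> ennreal \<bar>f t\<bar> / ennreal (H_norm \<Phi> f)"
    using c N by (intro ennreal_le_divide_of_mult_le) (auto simp: H_norm_def)
  also have "f t = f t - (\<Sum>k=1..n. f (x k) * u k)"
    using vanish by simp
  finally show "ennreal c \<le> (SUP f \<in> H_space \<Phi> - {\<lambda>_. 0}.
      ennreal \<bar>f t - (\<Sum>k=1..n. f (x k) * u k)\<bar> / ennreal (H_norm \<Phi> f))"
    using f N vanish by (intro SUP_upper2[of f]) auto
qed

lemma mult_le_of_squares:
  fixes c H X N :: real
  assumes "0 \<le> c" "H\<^sup>2 \<le> X" "c\<^sup>2 * X \<le> N\<^sup>2" "0 \<le> N"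
  shows "c * H \<le> N"
proof (rule power2_le_imp_le)
  have "(c * H)\<^sup>2 \<le> c\<^sup>2 * X"
    unfolding power_mult_distrib using assms by (intro mult_left_mono) auto
  then show "(c * H)\<^sup>2 \<le> N\<^sup>2" using assms by linarith
qed (use assms in auto)

definition node_poly :: "nat \<Rightarrow> (nat \<Rightarrow> real) \<Rightarrow> real poly" where
  "node_poly n x = (\<Prod>k=1..n. [:- x k, 1:])"

lemma poly_node_poly: "poly (node_poly n x) t = (\<Prod>k=1..n. t - x k)"
  by (simp add: node_poly_def poly_prod)

lemma degree_node_poly: "degree (node_poly n x) = n"
  unfolding node_poly_def by (subst degree_prod_sum_eq) auto

lemma coeff_node_poly: "coeff (node_poly n x) n = 1"
  using lead_coeff_prod[of "\<lambda>k. [:- x k, 1:]" "{1..n}"] degree_node_poly[of n x]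
  by (simp add: node_poly_def)

lemma weighted_coeff_sum_pos:
  assumes "0 \<le> lam"
  shows "1 \<le> (\<Sum>k\<le>n. (coeff (node_poly n x) k)\<^sup>2 * (lam ^ (n - k) * fact k / fact n))"
proof -
  have "(\<lambda>k. (coeff (node_poly n x) k)\<^sup>2 * (lam ^ (n - k) * fact k / fact n)) n
     \<le> (\<Sum>k\<le>n. (coeff (node_poly n x) k)\<^sup>2 * (lam ^ (n - k) * fact k / fact n))"
    using assms by (intro member_le_sum) auto
  then show ?thesis by (simp add: coeff_node_poly)
qed

lemma exp_half_square: "(exp (- (1 / 32) * lam\<^sup>2))\<^sup>2 * exp (lam\<^sup>2 / 16) = (1::real)"
  by (simp add: power2_eq_square flip: exp_add)

text \<open>
  With \<open>b = beta \<Phi> n\<close> and \<open>r\<close> a power of \<open>2\<close>, this is the square of the claimed bound times the bound for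
  \<open>\<parallel>f\<parallel>\<^sub>K\<^sup>2\<close>.
\<close>
lemma bound_square:
  fixes a b :: real
  assumes "0 < b"
  shows "(a * real (n + 1) powr (-1/2) * r * b powr (-1/2))\<^sup>2 * (real (n + 1) * b * S) = a\<^sup>2 * r\<^sup>2 * S"
proof -
  have p: "(y powr (-1/2))\<^sup>2 * y = 1" if "0 < y" for y :: real
  proof -
    have "(y powr (-1/2))\<^sup>2 = y powr (-1)"
      using that by (simp add: power2_eq_square flip: powr_add)
    then show ?thesis using that by (simp add: powr_minus)
  qed
  have p1: "(real (n + 1) powr (-1/2))\<^sup>2 * real (n + 1) = 1" by (rule p) simp
  have p2: "(b powr (-1/2))\<^sup>2 * b = 1" by (rule p[OF assms])
  have "(a * real (n + 1) powr (-1/2) * r * b powr (-1/2))\<^sup>2 * (real (n + 1) * b * S)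
     = a\<^sup>2 * r\<^sup>2 * S * ((real (n + 1) powr (-1/2))\<^sup>2 * real (n + 1)) * ((b powr (-1/2))\<^sup>2 * b)"
    by (simp only: power_mult_distrib mult_ac)
  then show ?thesis by (simp only: p1 p2 mult_1_right)
qed

lemma powr_minus_nat: "2 powr (- real n) = 1 / 2 ^ n"
  by (simp add: powr_minus powr_realpow inverse_eq_divide)

lemma powr_minus_2_nat: "2 powr (- 2 * real n) = 1 / 4 ^ n"
proof -
  have "2 powr (- 2 * real n) = 2 powr (- real (2 * n))" by simp
  then show ?thesis unfolding powr_minus_nat by (simp add: power_mult)
qed

lemma c1_inf_square:
  assumes "0 < lam"
  shows "(c1_inf lam m)\<^sup>2 * ((1 + lam) / 2 * exp (lam\<^sup>2 / 16)) = m\<^sup>2"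
proof -
  have "(c1_inf lam m)\<^sup>2 * ((1 + lam) / 2 * exp (lam\<^sup>2 / 16))
     = ((sqrt (2 / (1 + lam)))\<^sup>2 * ((1 + lam) / 2)) * ((exp (- (1 / 32) * lam\<^sup>2))\<^sup>2 * exp (lam\<^sup>2 / 16)) * m\<^sup>2"
    unfolding c1_inf_def by (simp only: power_mult_distrib mult_ac)
  also have "(sqrt (2 / (1 + lam)))\<^sup>2 * ((1 + lam) / 2) = 1" using assms by simp
  finally show ?thesis by (simp only: exp_half_square mult_1)
qed

text \<open>
  The left-hand side is \<open>2 m\<^sup>2 / (9 e\<^sup>6)\<close>, so that there is room to spare in the constant.
\<close>
lemma c1_two_square_le:
  assumes "0 < lam"
  shows "(c1_two lam m)\<^sup>2 * (3 / (4 * pi) * (4 + lam) * exp (lam\<^sup>2 / 16)) \<le> m\<^sup>2"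
proof -
  define d where "d = 2 * sqrt (2 * pi) / (3 * exp 3 * sqrt (3 * (4 + lam)))"
  have d2: "d\<^sup>2 * (3 / (4 * pi) * (4 + lam)) = 2 / (9 * (exp 3)\<^sup>2)"
  proof -
    define k E where "k = 4 + lam" and "E = (exp 3 :: real)\<^sup>2"
    have pos: "0 < k" "0 < E" using assms by (auto simp: k_def E_def)
    have "d\<^sup>2 = 4 * (2 * pi) / (9 * E * (3 * k))"
      unfolding d_def k_def[symmetric] using pos by (simp add: power_mult_distrib power_divide E_def)
    then show ?thesis unfolding k_def[symmetric] E_def[symmetric] using pos by (simp add: field_simps)
  qed
  have "(c1_two lam m)\<^sup>2 * (3 / (4 * pi) * (4 + lam) * exp (lam\<^sup>2 / 16))
     = (d\<^sup>2 * (3 / (4 * pi) * (4 + lam))) * ((exp (- (1 / 32) * lam\<^sup>2))\<^sup>2 * exp (lam\<^sup>2 / 16)) * m\<^sup>2"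
    unfolding c1_two_def d_def[symmetric] by (simp only: power_mult_distrib mult_ac)
  also have "\<dots> = 2 / (9 * (exp 3)\<^sup>2) * m\<^sup>2" by (simp only: d2 exp_half_square mult_1_right)
  also have "\<dots> \<le> 1 * m\<^sup>2"
  proof (rule mult_right_mono)
    have "(1::real) \<le> (exp 3)\<^sup>2" by (simp add: one_le_power)
    then have "2 \<le> 9 * (exp 3 :: real)\<^sup>2" by linarith
    then show "2 / (9 * (exp 3)\<^sup>2) \<le> (1::real)" by (simp add: divide_simps)
  qed simp
  finally show ?thesis by simp
qed

text \<open>
  \<open>m\<close> stands for \<open>\<Phi>min\<close>.  The degenerate case that \<open>beta \<Phi> n\<close> is zero is left out here: in it the bounds
  claimed in the theorem are \<open>0\<close>, because \<open>0 powr (-1/2) = 0\<close>.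
\<close>
locale lower_bound_setting = smooth_kernel +
  fixes lam m :: real and n :: nat and x :: "nat \<Rightarrow> real"
  assumes m: "0 < m" "\<And>t. t \<in> {-1..1} \<Longrightarrow> m \<le> \<bar>\<Phi> t\<bar>" and lam: "0 < lam"
    and ratio: "\<And>k. k \<le> n \<Longrightarrow> beta \<Phi> k / beta \<Phi> n \<le> ennreal (lam ^ (n - k) * fact k / fact n)"
    and n: "1 \<le> n" and x: "\<And>k. k \<in> {1..n} \<Longrightarrow> x k \<in> {-1..1}"
    and beta_pos: "0 < enn2real (beta \<Phi> n)"
begin

abbreviation "q \<equiv> node_poly n x"
abbreviation "f \<equiv> poly_kernel q"
abbreviation "b \<equiv> enn2real (beta \<Phi> n)"
definition "S = (\<Sum>k\<le>n. (coeff q k)\<^sup>2 * (lam ^ (n - k) * fact k / fact n))"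

lemma f_vanishes: "k \<in> {1..n} \<Longrightarrow> f (x k) = 0"
  by (auto simp: poly_kernel_def poly_node_poly)

lemma abs_f_ge: "t \<in> {-1..1} \<Longrightarrow> \<bar>m * poly q t\<bar> \<le> \<bar>f t\<bar>"
  using m mult_right_mono[OF m(2)[of t], of "\<bar>poly q t\<bar>"] by (simp add: poly_kernel_def abs_mult mult.commute)

lemma H_norm_f: "(H_norm \<Phi> f)\<^sup>2 \<le> real (n + 1) * b * S"
  unfolding S_def using beta_pos ratio lam
  by (intro H_norm_poly_kernel_sq_le) (auto simp: degree_node_poly)

lemma S_ge_1: "1 \<le> S"
  unfolding S_def using lam by (intro weighted_coeff_sum_pos) simp

lemma S_le_sup:
  assumes "\<And>t. t \<in> {-1..1} \<Longrightarrow> \<bar>poly q t\<bar> \<le> M"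
  shows "S \<le> (1 + lam) / 2 * exp (lam\<^sup>2 / 16) * 4 ^ n * M\<^sup>2"
  unfolding S_def using lam n assms
  by (intro coeff_weighted_sum_le_sup) (auto simp: degree_node_poly)

lemma S_le_L2: "S \<le> 3 / (4 * pi) * (4 + lam) * exp (lam\<^sup>2 / 16) * 4 ^ n * integral {-1..1} (\<lambda>t. (poly q t)\<^sup>2)"
  unfolding S_def using lam n
  by (intro coeff_weighted_sum_le_L2) (auto simp: degree_node_poly)

text \<open>
  Otherwise \<open>q\<close> would vanish on \<open>[-1, 1]\<close>, and \<open>S_le_sup\<close> with \<open>M = 0\<close> would contradict \<open>S_ge_1\<close>.
\<close>
lemma f_nonzero: "f \<noteq> (\<lambda>_. 0)"
proof
  assume f0: "f = (\<lambda>_. 0)"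
  have "\<bar>poly q t\<bar> \<le> 0" if "t \<in> {-1..1}" for t
    using abs_f_ge[OF that] m fun_cong[OF f0, of t] by (simp add: abs_mult mult_le_0_iff)
  from S_le_sup[OF this] S_ge_1 show False by simp
qed

lemma e_min_pts_inf_ge:
  "ennreal (c1_inf lam m * real (n + 1) powr (-1/2) * 2 powr (- real n) * b powr (-1/2)) \<le> e_min_pts \<Phi> \<infinity> n x"
proof -
  have "compact {-1..1::real}" "{-1..1::real} \<noteq> {}" "continuous_on {-1..1} (\<lambda>t. \<bar>poly q t\<bar>)"
    by (auto intro!: continuous_intros)
  then obtain t0 where t0: "t0 \<in> {-1..1}" "\<And>t. t \<in> {-1..1} \<Longrightarrow> \<bar>poly q t\<bar> \<le> \<bar>poly q t0\<bar>"
    using continuous_attains_sup[of "{-1..1}" "\<lambda>t. \<bar>poly q t\<bar>"] by blast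
  define M where "M = \<bar>poly q t0\<bar>"
  have S: "S \<le> (1 + lam) / 2 * exp (lam\<^sup>2 / 16) * 4 ^ n * M\<^sup>2"
    using t0(2) by (intro S_le_sup) (simp add: M_def)
  have "M \<noteq> 0" using S S_ge_1 by auto
  then have M: "0 < M" by (simp add: M_def)
  let ?c = "c1_inf lam m * real (n + 1) powr (-1/2) * 2 powr (- real n) * b powr (-1/2)"
  have "?c\<^sup>2 * (real (n + 1) * b * S) = (c1_inf lam m)\<^sup>2 * (1 / 2 ^ n)\<^sup>2 * S"
    unfolding powr_minus_nat by (rule bound_square[OF beta_pos])
  also have "\<dots> \<le> (c1_inf lam m)\<^sup>2 * (1 / 2 ^ n)\<^sup>2 * ((1 + lam) / 2 * exp (lam\<^sup>2 / 16) * 4 ^ n * M\<^sup>2)"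
    by (intro mult_left_mono S) auto
  also have "\<dots> = ((c1_inf lam m)\<^sup>2 * ((1 + lam) / 2 * exp (lam\<^sup>2 / 16))) * M\<^sup>2"
    by (simp add: power_divide square_power_two)
  also have "\<dots> = (m * M)\<^sup>2" unfolding c1_inf_square[OF lam] by (simp add: power_mult_distrib)
  finally have c2: "?c\<^sup>2 * (real (n + 1) * b * S) \<le> (m * M)\<^sup>2" .
  have "ennreal (m * M) \<le> ennreal \<bar>f t0\<bar>"
    using abs_f_ge[OF t0(1)] m by (intro ennreal_leI) (simp add: M_def abs_mult)
  also have "\<dots> \<le> Lp_norm \<infinity> f"
    by (rule Lp_norm_inf_ge[OF poly_kernel_continuous t0(1)])
  finally have "ennreal (m * M) \<le> Lp_norm \<infinity> f" .
  moreover have "?c * H_norm \<Phi> f \<le> m * M"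
    using m(1) M lam by (intro mult_le_of_squares[OF _ H_norm_f c2]) (auto simp: c1_inf_def)
  ultimately show ?thesis
    using m(1) M by (intro e_min_pts_ge[OF poly_kernel_in_H_space f_vanishes _ _ f_nonzero]) auto
qed

lemma e_min_pts_2_ge:
  "ennreal (c1_two lam m * real (n + 1) powr (-1/2) * 2 powr (- real n) * b powr (-1/2)) \<le> e_min_pts \<Phi> 2 n x"
proof -
  define J where "J = integral {-1..1} (\<lambda>t. (poly q t)\<^sup>2)"
  note S = S_le_L2[folded J_def]
  have J0: "0 \<le> J" unfolding J_def by (intro integral_nonneg integrable_continuous_real continuous_intros) auto
  have "J \<noteq> 0" using S S_ge_1 by auto
  then have J: "0 < J" using J0 by simp
  let ?c = "c1_two lam m * real (n + 1) powr (-1/2) * 2 powr (- real n) * b powr (-1/2)"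
  have "?c\<^sup>2 * (real (n + 1) * b * S) = (c1_two lam m)\<^sup>2 * (1 / 2 ^ n)\<^sup>2 * S"
    unfolding powr_minus_nat by (rule bound_square[OF beta_pos])
  also have "\<dots> \<le> (c1_two lam m)\<^sup>2 * (1 / 2 ^ n)\<^sup>2 * (3 / (4 * pi) * (4 + lam) * exp (lam\<^sup>2 / 16) * 4 ^ n * J)"
    by (intro mult_left_mono S) auto
  also have "\<dots> = ((c1_two lam m)\<^sup>2 * (3 / (4 * pi) * (4 + lam) * exp (lam\<^sup>2 / 16))) * J"
    by (simp add: power_divide square_power_two)
  also have "\<dots> \<le> m\<^sup>2 * J" by (intro mult_right_mono c1_two_square_le lam J0)
  also have "\<dots> = (m * sqrt J)\<^sup>2" using J0 by (simp add: power_mult_distrib)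
  finally have c2: "?c\<^sup>2 * (real (n + 1) * b * S) \<le> (m * sqrt J)\<^sup>2" .
  have "m * sqrt J = sqrt (integral {-1..1} (\<lambda>t. (m * poly q t)\<^sup>2))"
    using m(1) by (simp add: J_def power_mult_distrib real_sqrt_mult)
  moreover have "ennreal (sqrt (integral {-1..1} (\<lambda>t. (m * poly q t)\<^sup>2))) \<le> Lp_norm 2 f"
    by (intro Lp_norm_2_ge abs_f_ge continuous_intros)
  ultimately have "ennreal (m * sqrt J) \<le> Lp_norm 2 f" by simp
  moreover have "0 < m * sqrt J" using m(1) J by simp
  moreover have "?c * H_norm \<Phi> f \<le> m * sqrt J"
    using m(1) J lam by (intro mult_le_of_squares[OF _ H_norm_f c2]) (auto simp: c1_two_def)
  ultimately show ?thesis
    using m(1) J by (intro e_min_pts_ge[OF poly_kernel_in_H_space f_vanishes _ _ f_nonzero]) auto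
qed

text \<open>
  Dividing by \<open>\<bar>q t\<bar>\<close> removes \<open>q\<close> from the numerator; in the denominator the distances \<open>\<bar>s - x k\<bar> \<le> 2\<close> bound
  \<open>q\<close> by \<open>2 ^ n\<close> on the interval, which costs a second factor \<open>2 ^ n\<close>.
\<close>
lemma e_min_at_quotient_ge:
  assumes t: "t \<in> {-1..1} - x ` {1..n}"
  shows "ennreal (c1_inf lam m * real (n + 1) powr (-1/2) * 2 powr (- 2 * real n) * b powr (-1/2))
    \<le> e_min_at \<Phi> n x t / ennreal \<bar>\<Prod>k=1..n. t - x k\<bar>"
proof -
  define P where "P = \<bar>poly q t\<bar>"
  have "poly q t \<noteq> 0" using t by (auto simp: poly_node_poly)
  then have P: "0 < P" by (simp add: P_def)
  have "\<bar>poly q s\<bar> \<le> 2 ^ n" if "s \<in> {-1..1}" for s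
  proof -
    have "\<bar>poly q s\<bar> = (\<Prod>k=1..n. \<bar>s - x k\<bar>)" by (simp add: poly_node_poly abs_prod)
    also have "\<dots> \<le> (\<Prod>k=1..n. 2)"
    proof (rule prod_mono)
      fix k assume "k \<in> {1..n}"
      then show "0 \<le> \<bar>s - x k\<bar> \<and> \<bar>s - x k\<bar> \<le> 2" using x[of k] that by auto
    qed
    finally show ?thesis by simp
  qed
  then have S: "S \<le> (1 + lam) / 2 * exp (lam\<^sup>2 / 16) * 4 ^ n * (2 ^ n)\<^sup>2" by (rule S_le_sup)
  let ?c = "c1_inf lam m * real (n + 1) powr (-1/2) * 2 powr (- 2 * real n) * b powr (-1/2)"
  have "?c\<^sup>2 * (real (n + 1) * b * S) = (c1_inf lam m)\<^sup>2 * (1 / 4 ^ n)\<^sup>2 * S"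
    unfolding powr_minus_2_nat by (rule bound_square[OF beta_pos])
  also have "\<dots> \<le> (c1_inf lam m)\<^sup>2 * (1 / 4 ^ n)\<^sup>2 * ((1 + lam) / 2 * exp (lam\<^sup>2 / 16) * 4 ^ n * (2 ^ n)\<^sup>2)"
    by (intro mult_left_mono S) auto
  also have "\<dots> = (c1_inf lam m)\<^sup>2 * ((1 + lam) / 2 * exp (lam\<^sup>2 / 16))"
    by (simp add: power_divide square_power_two) (simp add: power2_eq_square)
  finally have c2: "?c\<^sup>2 * (real (n + 1) * b * S) \<le> m\<^sup>2" unfolding c1_inf_square[OF lam] .
  have "0 \<le> ?c" using lam m by (simp add: c1_inf_def)
  with c2 m have "?c * H_norm \<Phi> f \<le> m" by (intro mult_le_of_squares[OF _ H_norm_f c2]) auto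
  then have "(?c * P) * H_norm \<Phi> f \<le> m * P"
    using mult_right_mono[of "?c * H_norm \<Phi> f" m P] P by (simp only: mult_ac less_imp_le)
  moreover have "m * P \<le> \<bar>f t\<bar>" using abs_f_ge[of t] t m by (simp add: P_def abs_mult)
  ultimately have "ennreal (?c * P) \<le> e_min_at \<Phi> n x t"
    using m(1) P by (intro e_min_at_ge[OF poly_kernel_in_H_space f_vanishes, where N = "m * P"]) auto
  then have "ennreal (?c * P) / ennreal P \<le> e_min_at \<Phi> n x t / ennreal P"
    by (rule divide_right_mono_ennreal)
  moreover have "ennreal (?c * P) / ennreal P = ennreal ?c"
    using P \<open>0 \<le> ?c\<close> by (subst divide_ennreal) auto
  ultimately show ?thesis by (simp only: P_def poly_node_poly)
qed

end

theorem theorem4p1: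
  fixes \<Phi> :: "real \<Rightarrow> real" and p :: ennreal and \<Phi>min lam :: real
  assumes "continuous_on UNIV \<Phi>"
    and "integrable lborel \<Phi>"
    and "psd_function \<Phi>"
    and "p \<in> {2, \<infinity>}"
    and "0 < \<Phi>min"
    and "\<And>x. x \<in> {-1..1} \<Longrightarrow> \<Phi>min \<le> \<bar>\<Phi> x\<bar>"
    and "infinitely_differentiable (fourier_real \<Phi>)"
    and "0 < lam"
    and "\<And>n. beta \<Phi> n < \<infinity>"
    and "\<And>n k. k \<le> n \<Longrightarrow> beta \<Phi> k / beta \<Phi> n \<le> ennreal (lam ^ (n - k) * fact k / fact n)"
  shows "\<forall>n\<ge>1. \<forall>x :: nat \<Rightarrow> real. (\<forall>k\<in>{1..n}. x k \<in> {-1..1}) \<longrightarrow>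
           ennreal (c1 p lam \<Phi>min * real (n + 1) powr (-1/2) * 2 powr (- real n)
                      * enn2real (beta \<Phi> n) powr (-1/2))
             \<le> e_min_pts \<Phi> p n x \<and>
           ennreal (c1 p lam \<Phi>min * real (n + 1) powr (-1/2) * 2 powr (- real n)
                      * enn2real (beta \<Phi> n) powr (-1/2))
             \<le> e_min \<Phi> p n \<and>
           (\<forall>t \<in> {-1..1} - x ` {1..n}.
              ennreal (c1 \<infinity> lam \<Phi>min * real (n + 1) powr (-1/2) * 2 powr (- 2 * real n)
                         * enn2real (beta \<Phi> n) powr (-1/2))
                \<le> e_min_at \<Phi> n x t / ennreal \<bar>\<Prod>k=1..n. t - x k\<bar>)"
proof (intro allI impI)
  fix n :: nat and x :: "nat \<Rightarrow> real"
  assume n: "1 \<le> n" and x: "\<forall>k\<in>{1..n}. x k \<in> {-1..1}"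
  let ?low = "\<lambda>c r. ennreal (c * real (n + 1) powr (-1/2) * r * enn2real (beta \<Phi> n) powr (-1/2))"
  have setting: "lower_bound_setting \<Phi> lam \<Phi>min n y"
    if "\<forall>k\<in>{1..n}. y k \<in> {-1..1}" "enn2real (beta \<Phi> n) \<noteq> 0" for y
    using assms that n by unfold_locales (auto simp: less_le)
  have pts: "?low (c1 p lam \<Phi>min) (2 powr (- real n)) \<le> e_min_pts \<Phi> p n y"
    if "\<forall>k\<in>{1..n}. y k \<in> {-1..1}" for y
  proof (cases "enn2real (beta \<Phi> n) = 0")
    case False
    interpret lower_bound_setting \<Phi> lam \<Phi>min n y by (rule setting[OF that False])
    show ?thesis using e_min_pts_inf_ge e_min_pts_2_ge assms(4) by (auto simp: c1_def)
  qed simp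
  moreover have "?low (c1 p lam \<Phi>min) (2 powr (- real n)) \<le> e_min \<Phi> p n"
    unfolding e_min_def by (rule INF_greatest) (simp only: mem_Collect_eq pts)
  moreover have "?low (c1 \<infinity> lam \<Phi>min) (2 powr (- 2 * real n)) \<le> e_min_at \<Phi> n x t / ennreal \<bar>\<Prod>k=1..n. t - x k\<bar>"
    if "t \<in> {-1..1} - x ` {1..n}" for t
  proof (cases "enn2real (beta \<Phi> n) = 0")
    case False
    interpret lower_bound_setting \<Phi> lam \<Phi>min n x by (rule setting[OF x False])
    show ?thesis using e_min_at_quotient_ge[OF that] by (simp add: c1_def)
  qed simp
  ultimately show "?low (c1 p lam \<Phi>min) (2 powr (- real n)) \<le> e_min_pts \<Phi> p n x \<and>
      ?low (c1 p lam \<Phi>min) (2 powr (- real n)) \<le> e_min \<Phi> p n \<and>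
      (\<forall>t \<in> {-1..1} - x ` {1..n}.
        ?low (c1 \<infinity> lam \<Phi>min) (2 powr (- 2 * real n)) \<le> e_min_at \<Phi> n x t / ennreal \<bar>\<Prod>k=1..n. t - x k\<bar>)"
    using x by blast
qed

end
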